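(* Let $\mathscr{G}=(\mathscr{V},\mathscr{E})$ be a random graph with vertices located in $\mathbb{R}^d$ that satisfies the standing assumptions (simple translation-invariant vertex locations, translation invariance of the graph, local finiteness). Suppose that $\mathscr{G}$ is polynomially mixing with some exponent $\xi<0$ and satisfies the polynomial "no long edges" property with some exponent $\mu<-d$ (all notions as defined in the context). Then there exists a constant $\eta>0$, depending only on model parameters, such that for all $L\in\mathbb{N}$, $$\limsup_{m\to\infty}\frac{\log \mathbb{P}\big(\neg\mathcal{D}^{\eta}_{L}(m)\big)}{\log m}\ \leq\ \xi\vee(d+\mu),$$ where $$\mathcal{D}^{\eta}_{L}(m)=\big\{\operatorname{d}(\boldsymbol{x},\boldsymbol{y})\geq \eta|x-y| \text{ for all vertices } \boldsymbol{x}\in\mathscr{V}\cap\Lambda_L(o) \text{ and } \boldsymbol{y}\in\mathscr{V}\cap\Lambda_m(o)^{\mathsf c}\big\}.$$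
   Context: Standing assumptions. $\mathscr{G}=(\mathscr{V},\mathscr{E})$ is a countably infinite random graph on a probability space with measure $\mathbb{P}$. Each vertex $\boldsymbol{x}\in\mathscr{V}$ has a location $x\in\mathbb{R}^d$ and may carry additional marks; $\boldsymbol{x}\in\mathscr{V}\cap A$ means that $x\in A$. - The vertex locations form a simple, translation-invariant point process. Both stationary point processes on $\mathbb{R}^d$ and site-percolation processes on the lattice $\mathbb{Z}^d$ are allowed; in the lattice case translations are those by elements of $\mathbb{Z}^d$. - $\mathscr{G}$ is translation invariant: $\mathscr{G}$ and $\mathscr{G}+x$ have the same distribution, where $\mathscr{G}+x$ is the graph with all vertex locations shifted by $x$ (marks and connection mechanism unchanged). - $\mathscr{G}$ is locally finite: almost surely all vertices have finite degree. Notation. $|\cdot|$ is the Euclidean norm, $o$ is the origin, $\Lambda_m(x)=x+[-m/2,m/2)^d$, $\neg$ denotes the complement of an event, $a\vee b=\max\{a,b\}$, and $\boldsymbol{x}\sim\boldsymbol{y}$ means that $\boldsymbol{x},\boldsymbol{y}$ are joined by an edge. $\operatorname{d}(\boldsymbol{x},\boldsymbol{y})$ is the graph distance in $\mathscr{G}$ (the minimal number of edges of a path from $\boldsymbol{x}$ to $\boldsymbol{y}$, with $\min\emptyset=\infty$). $\log 0=-\infty$. Local events. An event $\mathcal{E}(\Lambda_m(o))$ is local if it is decided by the vertices and edges internal to $\Lambda_m(o)$ alone, i.e. $\mathbb{E}[\mathbf{1}_{\mathcal{E}(\Lambda_m(o))}\mid\mathscr{G}\cap\Lambda_m(o)]\in\{0,1\}$.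 A local event $\mathcal{E}(\cdot)$ is understood as such an event for each $m$, and $\mathcal{E}(\Lambda_m(y))$ is the corresponding event for the translated box. Polynomial mixing with exponent $\xi<0$: for every local event $\mathcal{E}(\cdot)$ there is a constant $C_{\mathrm{mix}}>0$ (possibly depending on the event, but not on $m$) such that for all sufficiently large $m$, $$\sup_{x}\operatorname{Cov}\big(\mathbf{1}_{\mathcal{E}(\Lambda_m(o))},\mathbf{1}_{\mathcal{E}(\Lambda_m(mx))}\big)\leq C_{\mathrm{mix}}\,m^{\xi},$$ where the supremum is over $x$ with $|x|>2$ for which the boxes $\Lambda_m(o)$ and $\Lambda_m(mx)$ are at distance at least $m$ (in the lattice case $mx\in\mathbb{Z}^d$). No long edges property with exponent $\mu<-d$: for $m,n\in\mathbb{N}$ let $\mathcal{L}(m,n)=\{\exists\,\boldsymbol{x}\sim\boldsymbol{y}: x,y\in\Lambda_m(o)\text{ and }|x-y|>n\}$. There is a constant $C_{\mathcal{L}}>0$ such that $\mathbb{P}(\mathcal{L}(m,n))\leq C_{\mathcal{L}}\,m^d n^{\mu}$ for all $m\geq1$ and all sufficiently large $n$. *)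

theory Defs
  imports "HOL-Probability.Probability"
begin

text \<open>A vertex is a location together with a mark. A graph is a pair of its vertex set and its
  (symmetric) adjacency relation.\<close>

type_synonym ('d, 'k) vertex = "(real, 'd) vec \<times> 'k"
type_synonym ('d, 'k) graph = "('d, 'k) vertex set \<times> (('d, 'k) vertex \<times> ('d, 'k) vertex) set"

abbreviation verts :: "('d::finite, 'k) graph \<Rightarrow> ('d, 'k) vertex set" where
  "verts g \<equiv> fst g"

abbreviation edges :: "('d::finite, 'k) graph \<Rightarrow> (('d, 'k) vertex \<times> ('d, 'k) vertex) set" where
  "edges g \<equiv> snd g"

abbreviation loc :: "('d::finite, 'k) vertex \<Rightarrow> real^'d" where
  "loc v \<equiv> fst v"

definition cube :: "real \<Rightarrow> real^'d \<Rightarrow> (real^'d) set" where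
  "cube m x = {y. \<forall>i. x $ i - m / 2 \<le> y $ i \<and> y $ i < x $ i + m / 2}"

definition integer_lattice :: "(real^'d) set" where
  "integer_lattice = {x. \<forall>i. x $ i \<in> \<int>}"

definition shift :: "real^'d \<Rightarrow> ('d, 'k) graph \<Rightarrow> ('d, 'k) graph" where
  "shift t g = (let s = (\<lambda>v. (loc v + t, snd v)) in (s ` verts g, map_prod s s ` edges g))"

definition restrict_graph :: "(real^'d) set \<Rightarrow> ('d, 'k) graph \<Rightarrow> ('d, 'k) graph" where
  "restrict_graph A g = (let W = {v \<in> verts g. loc v \<in> A} in (W, edges g \<inter> W \<times> W))"

definition is_path :: "('d::finite, 'k) graph \<Rightarrow> ('d, 'k) vertex \<Rightarrow> ('d, 'k) vertex list \<Rightarrow> ('d, 'k) vertex \<Rightarrow> bool" where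
  "is_path g x p y \<longleftrightarrow> p \<noteq> [] \<and> hd p = x \<and> last p = y \<and> set p \<subseteq> verts g \<and> distinct p \<and>
     successively (\<lambda>u v. (u, v) \<in> edges g) p"

text \<open>The infimum of the empty set in \<^typ>\<open>enat\<close> is infinity.\<close>

definition graph_dist :: "('d::finite, 'k) graph \<Rightarrow> ('d, 'k) vertex \<Rightarrow> ('d, 'k) vertex \<Rightarrow> enat" where
  "graph_dist g x y = (INF p \<in> {p. is_path g x p y}. enat (length p - 1))"

text \<open>The space of spatial graph configurations with marks in the measurable space \<open>K\<close>: the vertex
  locations are simple (no two vertices share a location) and locally finite. Its sigma-algebra is
  the usual one for the pair of point processes formed by the vertices and by the edges: it is
  generated by the numbers of vertices and of (ordered) edges in measurable sets.\<close>

definition graph_configs :: "'k measure \<Rightarrow> ('d::finite, 'k) graph set" where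
  "graph_configs K = {g.
     verts g \<subseteq> UNIV \<times> space K \<and>
     inj_on loc (verts g) \<and>
     (\<forall>A. bounded A \<longrightarrow> finite {v \<in> verts g. loc v \<in> A}) \<and>
     edges g \<subseteq> verts g \<times> verts g \<and> sym (edges g) \<and> irrefl (edges g)}"

definition graph_space :: "'k measure \<Rightarrow> ('d::finite, 'k) graph measure" where
  "graph_space K = (let S = (borel :: (real^'d) measure) \<Otimes>\<^sub>M K in
     sigma (graph_configs K)
       ({{g \<in> graph_configs K. emeasure (count_space UNIV) (verts g \<inter> A) = n} | A n. A \<in> sets S} \<union>
        {{g \<in> graph_configs K. emeasure (count_space UNIV) (edges g \<inter> B) = n} | B n. B \<in> sets (S \<Otimes>\<^sub>M S)}))"

text \<open>The standing assumptions on a random graph \<open>G\<close>, a random element of the configuration space.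
  The group \<open>T\<close> of admissible translations is either the whole space (stationary point processes)
  or the integer lattice, in which case the vertices sit on lattice sites (site percolation).
  Translation invariance of the vertex locations is part of the invariance of the graph.\<close>

locale random_spatial_graph = prob_space M
  for M :: "'w measure" +
  fixes K :: "'k measure"
    and T :: "(real^'d) set"
    and G :: "'w \<Rightarrow> ('d, 'k) graph"
  assumes random_graph: "G \<in> measurable M (graph_space K)"
    and continuum_or_lattice: "T = UNIV \<or> T = integer_lattice"
    and locations: "AE \<omega> in M. loc ` verts (G \<omega>) \<subseteq> T"
    and infinite_verts: "AE \<omega> in M. infinite (verts (G \<omega>))"
    and translation_invariant:
      "\<And>t. t \<in> T \<Longrightarrow> distr M (graph_space K) (\<lambda>\<omega>. shift t (G \<omega>)) = distr M (graph_space K) G"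
    and locally_finite:
      "AE \<omega> in M. \<forall>v \<in> verts (G \<omega>). finite {u. (v, u) \<in> edges (G \<omega>)}"

definition covariance :: "'w measure \<Rightarrow> ('w \<Rightarrow> real) \<Rightarrow> ('w \<Rightarrow> real) \<Rightarrow> real" where
  "covariance M X Y =
     integral\<^sup>L M (\<lambda>\<omega>. (X \<omega> - integral\<^sup>L M X) * (Y \<omega> - integral\<^sup>L M Y))"

text \<open>The sigma-algebra generated by the subgraph induced by the vertices in \<open>A\<close>.\<close>

definition sigma_restrict ::
    "'w measure \<Rightarrow> 'k measure \<Rightarrow> ('w \<Rightarrow> ('d::finite, 'k) graph) \<Rightarrow> (real^'d) set \<Rightarrow> 'w measure" where
  "sigma_restrict M K G A =
     vimage_algebra (space M) (\<lambda>\<omega>. restrict_graph A (G \<omega>)) (graph_space K)"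

text \<open>A local event is a family \<open>E\<close>, indexed by the side length, of measurable sets of
  configurations. The event for the box \<^term>\<open>cube (real m) y\<close> is the event that the graph,
  translated by \<open>- y\<close>, lies in \<open>E m\<close>.\<close>

definition event_at :: "'w measure \<Rightarrow> ('w \<Rightarrow> ('d::finite, 'k) graph) \<Rightarrow> (nat \<Rightarrow> ('d, 'k) graph set) \<Rightarrow>
    nat \<Rightarrow> real^'d \<Rightarrow> 'w set" where
  "event_at M G E m y = {\<omega> \<in> space M. shift (- y) (G \<omega>) \<in> E m}"

definition local_event ::
    "'w measure \<Rightarrow> 'k measure \<Rightarrow> ('w \<Rightarrow> ('d::finite, 'k) graph) \<Rightarrow> (nat \<Rightarrow> ('d, 'k) graph set) \<Rightarrow> bool" where
  "local_event M K G E \<longleftrightarrow> (\<forall>m. E m \<in> sets (graph_space K) \<and>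
     (AE \<omega> in M. real_cond_exp M (sigma_restrict M K G (cube (real m) 0))
        (indicator (event_at M G E m 0)) \<omega> \<in> {0, 1}))"

definition polynomially_mixing ::
    "'w measure \<Rightarrow> 'k measure \<Rightarrow> (real^'d) set \<Rightarrow> ('w \<Rightarrow> ('d::finite, 'k) graph) \<Rightarrow> real \<Rightarrow> bool" where
  "polynomially_mixing M K T G \<xi> \<longleftrightarrow>
     (\<forall>E. local_event M K G E \<longrightarrow>
       (\<exists>C > 0. \<forall>\<^sub>F m in sequentially. \<forall>x.
          norm x > 2 \<and> real m *\<^sub>R x \<in> T \<and>
          setdist (cube (real m) 0) (cube (real m) (real m *\<^sub>R x)) \<ge> real m \<longrightarrow>
          covariance M (indicator (event_at M G E m 0)) (indicator (event_at M G E m (real m *\<^sub>R x)))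
            \<le> C * real m powr \<xi>))"

definition long_edge_event ::
    "'w measure \<Rightarrow> ('w \<Rightarrow> ('d::finite, 'k) graph) \<Rightarrow> nat \<Rightarrow> nat \<Rightarrow> 'w set" where
  "long_edge_event M G m n = {\<omega> \<in> space M. \<exists>x y. (x, y) \<in> edges (G \<omega>) \<and>
     loc x \<in> cube (real m) 0 \<and> loc y \<in> cube (real m) 0 \<and> norm (loc x - loc y) > real n}"

definition no_long_edges :: "'w measure \<Rightarrow> ('w \<Rightarrow> ('d::finite, 'k) graph) \<Rightarrow> real \<Rightarrow> bool" where
  "no_long_edges M G \<mu> \<longleftrightarrow>
     (\<exists>C > 0. \<forall>\<^sub>F n in sequentially. \<forall>m \<ge> 1.
        measure M (long_edge_event M G m n) \<le> C * real m ^ CARD('d) * real n powr \<mu>)"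

definition linear_dist_event ::
    "'w measure \<Rightarrow> ('w \<Rightarrow> ('d::finite, 'k) graph) \<Rightarrow> real \<Rightarrow> nat \<Rightarrow> real \<Rightarrow> 'w set" where
  "linear_dist_event M G \<eta> L m = {\<omega> \<in> space M. \<forall>x \<in> verts (G \<omega>). \<forall>y \<in> verts (G \<omega>).
     loc x \<in> cube (real L) 0 \<longrightarrow> loc y \<notin> cube m 0 \<longrightarrow>
     ereal_of_enat (graph_dist (G \<omega>) x y) \<ge> ereal (\<eta> * norm (loc x - loc y))}"

definition log_ereal :: "real \<Rightarrow> ereal" where
  "log_ereal p = (if p = 0 then -\<infinity> else ereal (ln p))"

end

theory Submission
  imports Defs "HOL-Real_Asymp.Real_Asymp"
begin

text \<open>
The proof is a renormalisation over a rapidly growing sequence of boxes. A box is bad if it contains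
a \<^emph>\<open>fast walk\<close>: a walk inside the box that covers a sup-distance \<open>r\<close> in fewer than
\<open>a * (r - b)\<close> steps, where the speed constant \<open>a\<close> and the slack \<open>b\<close> depend on the level. The level
\<open>k\<close> boxes have side \<open>8 * mesh N k\<close> and \<open>b\<close> is four sides of a box of the level below. This is a property of
the configuration inside the box alone, so it is a local event.

If a box of the next level is bad and has no edge longer than \<open>mesh N k\<close>, then two level \<open>k\<close> boxes
centred on a fixed grid are bad and far apart (\<open>fast_walk_imp_distant_fast_boxes\<close>). For
otherwise all bad level \<open>k\<close> boxes are clustered in a region of diameter below \<open>4\<close> sides. A
walk then accumulates its steps at the good rate, box after box, outside that region, and all it can gain by
crossing it is absorbed by the slack. The rate deteriorates by a factor
\<open>1 - slack N k / mesh N k\<close> because every good box used on the way contributes its own slack. With box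
ratios of order \<open>k\<^sup>2\<close> the product of these factors is positive, so the rates stay above a constant.

Write \<open>p k\<close> for the probability that the level \<open>k\<close> box is bad, \<open>s\<close> for \<open>mesh N k\<close>, \<open>q\<close> for the ratio to
the next level and \<open>d\<close> for the dimension. A union bound over pairs of
grid boxes, mixing, and the bound on long edges give
\<open>p (k+1) \<le> const * q\<^sup>2\<^sup>d * (p k ^ 2 + s powr \<xi> + s powr (d + \<mu>))\<close> (\<open>prob_fast_walk_step\<close>).
At level 0 the rate is so small that nothing is bad. The square
makes the recursion contract if the first box is large, and then \<open>p (k+1)\<close> is at most
a polynomial in \<open>k\<close> times \<open>s powr \<alpha>\<close> with \<open>\<alpha> = max \<xi> (d + \<mu>)\<close> (\<open>multiscale_bound\<close>). Boxes grow
superexponentially, so the polynomial costs nothing in the exponent.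

There is one circularity: how large the first box must be depends on the mixing constant, which may depend on
the event, which depends on the first box. It disappears because the mixing constant can be chosen
uniformly over all local events: a family that for every box size
picks a nearly worst event is itself a local event (\<open>uniform_mixing\<close>).

Finally, if no centred box of level at least \<open>k\<close> is bad or contains an edge too long for its level, then
every walk from near the origin that leaves the level \<open>k\<close> box is slow (\<open>walk_linear_lower_bound\<close>), and
the probabilities of the exceptional events are summed over the levels.
\<close>

section \<open>Chains of points with short steps and few bad points\<close>

text \<open>Cut the chain each time it has moved by more than \<open>s\<close>. A piece that starts outside \<open>B\<close> pays for its displacement
at rate \<open>c\<close>, so the elapsed time is at least \<open>c\<close> times the displacement until a piece starts in \<open>B\<close>. Steps of length at most \<open>s\<close> keep
each piece within distance \<open>2 * s\<close> of its start; only such pieces have to be controlled. The last,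
incomplete piece loses at most \<open>s\<close>.\<close>

lemma bad_point_on_chain:
  fixes x :: "nat \<Rightarrow> 'a::euclidean_space"
  assumes step: "\<And>i. i < l \<Longrightarrow> infnorm (x i - x (Suc i)) \<le> s"
    and good: "\<And>a b. a < b \<Longrightarrow> b \<le> l \<Longrightarrow> x a \<notin> B \<Longrightarrow>
      (\<And>i. a \<le> i \<Longrightarrow> i \<le> b \<Longrightarrow> infnorm (x a - x i) \<le> 2 * s) \<Longrightarrow> s < infnorm (x a - x b) \<Longrightarrow>
      c * infnorm (x a - x b) \<le> real b - real a"
    and c: "0 \<le> c" and s: "0 \<le> s" and t0: "t0 \<le> l"
  shows "c * (infnorm (x t0 - x l) - s) \<le> real l - real t0 \<or>
    (\<exists>t. t0 \<le> t \<and> t \<le> l \<and> x t \<in> B \<and> c * infnorm (x t0 - x t) \<le> real t - real t0)"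
  using t0
proof (induction "l - t0" arbitrary: t0 rule: less_induct)
  case less
  show ?case
  proof (cases "x t0 \<in> B")
    case True
    then show ?thesis
      using less.prems by (intro disjI2 exI[of _ t0]) (auto simp: infnorm_0)
  next
    case False
    show ?thesis
    proof (cases "\<exists>t. t0 \<le> t \<and> t \<le> l \<and> s < infnorm (x t0 - x t)")
      case no: False
      then have "infnorm (x t0 - x l) \<le> s"
        using less.prems by force
      then have "c * (infnorm (x t0 - x l) - s) \<le> 0"
        using c by (simp add: mult_nonneg_nonpos)
      then show ?thesis
        using less.prems by linarith
    next
      case True
      define t where "t = (LEAST t. t0 \<le> t \<and> t \<le> l \<and> s < infnorm (x t0 - x t))"
      have t: "t0 \<le> t" "t \<le> l" "s < infnorm (x t0 - x t)"
        using LeastI_ex[OF True] unfolding t_def by auto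
      have before: "infnorm (x t0 - x i) \<le> s" if "t0 \<le> i" "i < t" for i
        using not_less_Least[of i "\<lambda>t. t0 \<le> t \<and> t \<le> l \<and> s < infnorm (x t0 - x t)"] that t(2)
        unfolding t_def[symmetric] by auto
      have "t \<noteq> t0"
        using t(3) s by (auto simp: infnorm_0)
      with t(1) have "t0 < t" by simp
      have within: "infnorm (x t0 - x i) \<le> 2 * s" if "t0 \<le> i" "i \<le> t" for i
      proof (cases "i = t")
        case True
        obtain j where j: "t = Suc j" "t0 \<le> j"
          using \<open>t0 < t\<close> by (cases t) auto
        have "infnorm (x t0 - x t) \<le> infnorm (x t0 - x j) + infnorm (x j - x t)"
          using infnorm_triangle[of "x t0 - x j" "x j - x t"] by simp
        also have "\<dots> \<le> s + s"
          using before[of j] step[of j] j t(2) by (intro add_mono) auto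
        finally show ?thesis using True by simp
      next
        case False
        then show ?thesis using before[of i] that s by auto
      qed
      have jump: "c * infnorm (x t0 - x t) \<le> real t - real t0"
        using good[OF \<open>t0 < t\<close> t(2) False within t(3)] by blast
      have tri: "c * infnorm (x t0 - x z) \<le> c * infnorm (x t0 - x t) + c * infnorm (x t - x z)" for z
        using mult_left_mono[OF infnorm_triangle[of "x t0 - x t" "x t - x z"] c]
        by (simp add: algebra_simps)
      have "c * (infnorm (x t - x l) - s) \<le> real l - real t \<or>
          (\<exists>t'. t \<le> t' \<and> t' \<le> l \<and> x t' \<in> B \<and> c * infnorm (x t - x t') \<le> real t' - real t)"
        using less.hyps[of t] \<open>t0 < t\<close> t(2) less.prems by auto
      then show ?thesis
      proof
        assume "c * (infnorm (x t - x l) - s) \<le> real l - real t"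
        then have "c * (infnorm (x t0 - x l) - s) \<le> real l - real t0"
          using jump tri[of l] by (simp add: algebra_simps)
        then show ?thesis ..
      next
        assume "\<exists>t'. t \<le> t' \<and> t' \<le> l \<and> x t' \<in> B \<and> c * infnorm (x t - x t') \<le> real t' - real t"
        then obtain t' where t': "t \<le> t'" "t' \<le> l" "x t' \<in> B"
          "c * infnorm (x t - x t') \<le> real t' - real t" by blast
        then show ?thesis
          using jump tri[of t'] t(1) by (intro disjI2 exI[of _ t']) auto
      qed
    qed
  qed
qed

text \<open>A forward run from the start stops at some bad point, and a backward run from the end, down to that point only,
stops at another one. The two runs do not overlap in time, and in space they miss at most the
distance of the two bad points. Restricting the backward run to the part after the first bad point is what keeps
the times disjoint. The hypothesis on pieces is symmetric in time to serve both runs.\<close>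

lemma chain_lower_bound:
  fixes x :: "nat \<Rightarrow> 'a::euclidean_space"
  assumes step: "\<And>i. i < l \<Longrightarrow> infnorm (x i - x (Suc i)) \<le> s"
    and good: "\<And>a b. a \<le> l \<Longrightarrow> b \<le> l \<Longrightarrow> x a \<notin> B \<Longrightarrow>
      (\<And>i. min a b \<le> i \<Longrightarrow> i \<le> max a b \<Longrightarrow> infnorm (x a - x i) \<le> 2 * s) \<Longrightarrow>
      s < infnorm (x a - x b) \<Longrightarrow> c * infnorm (x a - x b) \<le> \<bar>real b - real a\<bar>"
    and diam: "\<And>p q. p \<in> B \<Longrightarrow> q \<in> B \<Longrightarrow> infnorm (p - q) \<le> D"
    and c: "0 \<le> c" and s: "0 \<le> s" and D: "0 \<le> D"
  shows "c * (infnorm (x 0 - x l) - (D + s)) \<le> real l"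
proof -
  have cD: "0 \<le> c * D" and cs: "0 \<le> c * s" using c D s by auto
  have tri: "c * infnorm (p - q) \<le> c * infnorm (p - r) + c * infnorm (r - q)" for p q r :: 'a
    using mult_left_mono[OF infnorm_triangle[of "p - r" "r - q"] c] by (simp add: algebra_simps)
  have fw: "c * infnorm (x a - x b) \<le> real b - real a"
    if "a < b" "b \<le> l" "x a \<notin> B" "\<And>i. a \<le> i \<Longrightarrow> i \<le> b \<Longrightarrow> infnorm (x a - x i) \<le> 2 * s"
      "s < infnorm (x a - x b)" for a b
    using good[of a b] that by auto
  have "c * (infnorm (x 0 - x l) - s) \<le> real l - real 0 \<or>
      (\<exists>t. 0 \<le> t \<and> t \<le> l \<and> x t \<in> B \<and> c * infnorm (x 0 - x t) \<le> real t - real 0)"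
    by (rule bad_point_on_chain[OF step fw c s]) auto
  then consider "c * (infnorm (x 0 - x l) - s) \<le> real l"
    | t where "t \<le> l" "x t \<in> B" "c * infnorm (x 0 - x t) \<le> real t" by auto
  then show ?thesis
  proof cases
    case 1
    then show ?thesis using cD by (simp add: algebra_simps)
  next
    case (2 t)
    \<comment> \<open>The backward run sees the reversed chain up to index \<open>l - t\<close> only.\<close>
    define y where "y i = x (l - i)" for i
    have ystep: "infnorm (y i - y (Suc i)) \<le> s" if "i < l - t" for i
    proof -
      have "l - i = Suc (l - Suc i)" using that by auto
      then show ?thesis
        using step[of "l - Suc i"] that unfolding y_def by (simp add: infnorm_sub)
    qed
    have ygood: "c * infnorm (y a - y b) \<le> real b - real a"
      if *: "a < b" "b \<le> l - t" "y a \<notin> B" "\<And>i. a \<le> i \<Longrightarrow> i \<le> b \<Longrightarrow> infnorm (y a - y i) \<le> 2 * s"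
      "s < infnorm (y a - y b)" for a b
    proof -
      have "infnorm (x (l - a) - x i) \<le> 2 * s"
        if "min (l - a) (l - b) \<le> i" "i \<le> max (l - a) (l - b)" for i
      proof -
        have "a \<le> l - i" "l - i \<le> b" "l - (l - i) = i" using that *(1,2) by auto
        then show ?thesis using *(4)[of "l - i"] by (simp add: y_def)
      qed
      then show ?thesis
        using good[of "l - a" "l - b"] * by (auto simp: y_def of_nat_diff)
    qed
    from bad_point_on_chain[of "l - t" y s B c 0, OF ystep ygood c s] 2(1)
    consider "c * (infnorm (x l - x t) - s) \<le> real l - real t"
      | t' where "t' \<le> l - t" "x (l - t') \<in> B" "c * infnorm (x l - x (l - t')) \<le> real t'"
      by (auto simp: y_def)
    then show ?thesis
    proof cases
      case 1
      then show ?thesis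
        using 2 tri[of "x 0" "x l" "x t"] cD infnorm_sub[of "x l" "x t"]
        by (simp add: algebra_simps)
    next
      case (2 t')
      have "infnorm (x t - x (l - t')) \<le> D"
        using diam \<open>x t \<in> B\<close> 2(2) by blast
      then have "c * infnorm (x t - x (l - t')) \<le> c * D"
        using c by (rule mult_left_mono)
      moreover have "c * infnorm (x 0 - x l) \<le>
          c * infnorm (x 0 - x t) + (c * infnorm (x t - x (l - t')) + c * infnorm (x l - x (l - t')))"
        using tri[of "x 0" "x l" "x t"] tri[of "x t" "x l" "x (l - t')"]
          infnorm_sub[of "x l" "x (l - t')"] by simp
      moreover have "real t + real t' \<le> real l"
        using 2(1) \<open>t \<le> l\<close> by linarith
      ultimately show ?thesis
        using 2(3) \<open>c * infnorm (x 0 - x t) \<le> real t\<close> cs by (simp add: algebra_simps)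
    qed
  qed
qed


section \<open>Fast walks and the passage from one scale to the next\<close>

definition walk :: "('d::finite, 'k) graph \<Rightarrow> (real^'d) set \<Rightarrow> nat \<Rightarrow> (nat \<Rightarrow> ('d, 'k) vertex) \<Rightarrow> bool"
  where "walk g W l u \<longleftrightarrow>
    (\<forall>i\<le>l. u i \<in> verts g \<and> loc (u i) \<in> W) \<and> (\<forall>i<l. (u i, u (Suc i)) \<in> edges g)"

text \<open>The slack \<open>b\<close> discards walks that cover only a short distance; for them no good rate can be expected, since
one bad region of smaller scale may dominate the whole walk.\<close>

definition fast_walk :: "('d::finite, 'k) graph \<Rightarrow> (real^'d) set \<Rightarrow> real \<Rightarrow> real \<Rightarrow> bool"
  where "fast_walk g W a b \<longleftrightarrow>
    (\<exists>l u. walk g W l u \<and> real l < a * (infnorm (loc (u 0) - loc (u l)) - b))"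

lemma walk_segment:
  assumes "walk g W l u" "a \<le> b" "b \<le> l" "\<And>i. a \<le> i \<Longrightarrow> i \<le> b \<Longrightarrow> loc (u i) \<in> V"
  shows "walk g V (b - a) (\<lambda>i. u (a + i))"
  using assms unfolding walk_def by auto

lemma walk_reverse:
  assumes "walk g W l u" "sym (edges g)"
  shows "walk g W l (\<lambda>i. u (l - i))"
  unfolding walk_def
proof (intro conjI allI impI)
  fix i assume "i < l"
  then have "(u (l - Suc i), u (Suc (l - Suc i))) \<in> edges g"
    using assms(1) unfolding walk_def by auto
  then show "(u (l - i), u (l - Suc i)) \<in> edges g"
    using symD[OF assms(2)] \<open>i < l\<close> by (simp add: Suc_diff_Suc)
qed (use assms in \<open>auto simp: walk_def\<close>)

text \<open>The indices \<open>i\<close> and \<open>j\<close> may come in either order because walks can be reversed; the backward run along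
a chain needs this.\<close>

lemma no_fast_walk_segment:
  assumes w: "walk g W l u" and sym: "sym (edges g)" and no: "\<not> fast_walk g V a b"
    and ij: "i \<le> l" "j \<le> l" and V: "\<And>k. min i j \<le> k \<Longrightarrow> k \<le> max i j \<Longrightarrow> loc (u k) \<in> V"
  shows "a * (infnorm (loc (u i) - loc (u j)) - b) \<le> \<bar>real j - real i\<bar>"
proof -
  have *: "a * (infnorm (loc (u i) - loc (u j)) - b) \<le> real j - real i"
    if "walk g W l u" "i \<le> j" "j \<le> l" "\<And>k. i \<le> k \<Longrightarrow> k \<le> j \<Longrightarrow> loc (u k) \<in> V" for u i j
    using no walk_segment[OF that] that(2) unfolding fast_walk_def
    by (fastforce simp: not_less of_nat_diff)
  show ?thesis
  proof (cases "i \<le> j")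
    case True
    then show ?thesis using *[OF w True ij(2)] V by auto
  next
    case False
    have *: "a * (infnorm (loc (u (l - (l - i))) - loc (u (l - (l - j)))) - b)
        \<le> real (l - j) - real (l - i)"
      using False ij V by (intro *[OF walk_reverse[OF w sym]]) auto
    have "real (l - j) - real (l - i) = real i - real j"
      using ij False by (simp add: of_nat_diff)
    then show ?thesis using * ij by auto
  qed
qed

lemma infnorm_le_iff_cart: "infnorm (z :: real^'d) \<le> r \<longleftrightarrow> (\<forall>i. \<bar>z $ i\<bar> \<le> r)"
proof -
  have "infnorm z \<le> r \<longleftrightarrow> (\<forall>x\<in>{\<bar>z $ i\<bar> |i. i \<in> UNIV}. x \<le> r)"
    unfolding infnorm_cart
    by (rule cSup_le_iff) (use bdd_above_finite[of "range (\<lambda>i. \<bar>z $ i\<bar>)"] in \<open>auto simp: full_SetCompr_eq\<close>)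
  then show ?thesis by auto
qed

text \<open>All points are integral, hence admissible translations both in the continuum and in the lattice case. Boxes will have
side \<open>8 * N\<close>, so that a quarter of the side, the spacing used below, and half of that spacing are integers.\<close>

definition grid :: "nat \<Rightarrow> nat \<Rightarrow> (real^'d::finite) set" where
  "grid s n = (\<lambda>j. \<chi> i. real s * real_of_int (j i)) ` (UNIV \<rightarrow>\<^sub>E {- int n..int n})"

lemma finite_grid: "finite (grid s n :: (real^'d::finite) set)"
  unfolding grid_def by (intro finite_imageI finite_PiE) auto

lemma card_grid_le: "card (grid s n :: (real^'d::finite) set) \<le> (2 * n + 1) ^ CARD('d)"
proof -
  have "card (grid s n :: (real^'d) set) \<le> card ((UNIV :: 'd set) \<rightarrow>\<^sub>E {- int n..int n})"
    unfolding grid_def by (intro card_image_le finite_PiE) auto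
  also have "\<dots> = (2 * n + 1) ^ CARD('d)"
    by (simp add: card_PiE nat_add_distrib) (simp add: nat_mult_distrib)
  finally show ?thesis .
qed

lemma grid_lattice: "grid s n \<subseteq> integer_lattice"
  unfolding grid_def integer_lattice_def by auto

lemma nearby_grid_point:
  fixes x :: "real^'d"
  assumes N: "0 < N" and x: "x \<in> cube (real (8 * N * C)) 0"
  shows "\<exists>w \<in> grid (2 * N) (2 * C). infnorm (x - w) \<le> real N"
proof
  define j where "j i = round (x $ i / real (2 * N))" for i
  have j: "\<bar>x $ i - real (2 * N) * real_of_int (j i)\<bar> \<le> real N" for i
  proof -
    have "\<bar>real_of_int (j i) - x $ i / real (2 * N)\<bar> \<le> 1 / 2"
      unfolding j_def by (rule of_int_round_abs_le)
    then have "real (2 * N) * \<bar>real_of_int (j i) - x $ i / real (2 * N)\<bar> \<le> real (2 * N) * (1 / 2)"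
      by (rule mult_left_mono) simp
    moreover have "real (2 * N) * (real_of_int (j i) - x $ i / real (2 * N))
        = real (2 * N) * real_of_int (j i) - x $ i"
      using N by (simp add: right_diff_distrib)
    then have "real (2 * N) * \<bar>real_of_int (j i) - x $ i / real (2 * N)\<bar>
        = \<bar>real (2 * N) * real_of_int (j i) - x $ i\<bar>"
      by (metis abs_mult abs_of_nat)
    ultimately show ?thesis by (simp add: abs_minus_commute)
  qed
  have "\<bar>j i\<bar> \<le> int (2 * C)" for i
  proof -
    have "\<bar>x $ i\<bar> \<le> real (4 * N * C)"
      using x unfolding cube_def
      by (simp add: abs_le_iff mult_ac) (meson less_imp_le minus_le_iff)
    then have "\<bar>real (2 * N) * real_of_int (j i)\<bar> \<le> real (4 * N * C) + real N"
      using j[of i] by linarith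
    then have "real N * (2 * real_of_int \<bar>j i\<bar>) \<le> real N * (4 * real C + 1)"
      by (simp add: abs_mult algebra_simps)
    then have "2 * real_of_int \<bar>j i\<bar> \<le> 4 * real C + 1"
      using N by (simp only: mult_le_cancel_left_pos of_nat_0_less_iff)
    then have "2 * \<bar>j i\<bar> \<le> 4 * int C + 1" by linarith
    then show ?thesis by linarith
  qed
  then have "\<And>i. j i \<in> {- int (2 * C)..int (2 * C)}"
    by (simp add: abs_le_iff) (smt (verit))
  then show "(\<chi> i. real (2 * N) * real_of_int (j i)) \<in> (grid (2 * N) (2 * C) :: (real^'d) set)"
    unfolding grid_def by (intro image_eqI[of _ _ j]) auto
  show "infnorm (x - (\<chi> i. real (2 * N) * real_of_int (j i))) \<le> real N"
    using j by (simp add: infnorm_le_iff_cart)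
qed

lemma in_cubeI: "infnorm (w - y) < r / 2 \<Longrightarrow> y \<in> cube r w"
proof -
  assume "infnorm (w - y) < r / 2"
  then have "\<bar>w $ i - y $ i\<bar> < r / 2" for i
    using infnorm_le_iff_cart[of "w - y" "infnorm (w - y)"] by (metis le_less_trans order_refl vector_minus_component)
  then have "w $ i - r / 2 \<le> y $ i \<and> y $ i < w $ i + r / 2" for i
    by (smt (verit) abs_less_iff)
  then show ?thesis unfolding cube_def by simp
qed

text \<open>Assign to each point a grid point within distance \<open>N\<close>. The bad points are those whose box of side
\<open>8 * N\<close> around their grid point contains a fast walk. If the centres of such boxes have pairwise
distance below \<open>24 * N\<close>, bad points have pairwise distance at most \<open>26 * N\<close>, and the chain bound
with \<open>s = N\<close> loses at most \<open>27 * N\<close>, less than the slack \<open>32 * N\<close>. A piece of the chain that starts at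
a good point stays within \<open>3 * N\<close> of the centre of its box, hence inside it. Its
displacement exceeds \<open>N\<close>, so its slack \<open>b\<close> costs at most the proportion \<open>b / N\<close>.\<close>

lemma fast_walk_imp_distant_fast_boxes:
  fixes g :: "('d::finite, 'k) graph"
  assumes sym: "sym (edges g)" and N: "0 < N"
    and fast: "fast_walk g (cube (real (8 * N * C)) 0) a' (4 * real (8 * N))"
    and short: "\<And>u v. (u, v) \<in> edges g \<Longrightarrow> loc u \<in> cube (real (8 * N * C)) 0 \<Longrightarrow>
      loc v \<in> cube (real (8 * N * C)) 0 \<Longrightarrow> norm (loc u - loc v) \<le> real N"
    and a: "0 \<le> a" "0 \<le> a'" and b: "0 \<le> b" and a': "a' \<le> a * (1 - b / real N)"
  shows "\<exists>w \<in> grid (2 * N) (2 * C). \<exists>w' \<in> grid (2 * N) (2 * C). 3 * real (8 * N) \<le> infnorm (w - w') \<and>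
    fast_walk g (cube (real (8 * N)) w) a b \<and> fast_walk g (cube (real (8 * N)) w') a b"
proof (rule ccontr)
  assume neg: "\<not> ?thesis"
  let ?Q = "cube (real (8 * N * C)) 0 :: (real^'d) set"
  obtain l u where w: "walk g ?Q l u"
    and l: "real l < a' * (infnorm (loc (u 0) - loc (u l)) - 4 * real (8 * N))"
    using fast unfolding fast_walk_def by blast
  obtain c where cJ: "\<And>x. x \<in> ?Q \<Longrightarrow> c x \<in> grid (2 * N) (2 * C)"
    and c: "\<And>x. x \<in> ?Q \<Longrightarrow> infnorm (x - c x) \<le> real N"
    using nearby_grid_point[OF N] by metis
  define B where "B = {x \<in> ?Q. fast_walk g (cube (real (8 * N)) (c x)) a b}"
  have uQ: "loc (u i) \<in> ?Q" if "i \<le> l" for i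
    using w that unfolding walk_def by blast
  have "a' * (infnorm (loc (u 0) - loc (u l)) - (26 * real N + real N)) \<le> real l"
  proof (rule chain_lower_bound[where B = B])
    fix i assume "i < l"
    then have "norm (loc (u i) - loc (u (Suc i))) \<le> real N"
      using w unfolding walk_def by (intro short) auto
    then show "infnorm (loc (u i) - loc (u (Suc i))) \<le> real N"
      using infnorm_le_norm order_trans by blast
  next
    fix i j assume ij: "i \<le> l" "j \<le> l" and nB: "loc (u i) \<notin> B"
      and near: "\<And>k. min i j \<le> k \<Longrightarrow> k \<le> max i j \<Longrightarrow> infnorm (loc (u i) - loc (u k)) \<le> 2 * real N"
      and far: "real N < infnorm (loc (u i) - loc (u j))"
    let ?r = "infnorm (loc (u i) - loc (u j))"
    have no: "\<not> fast_walk g (cube (real (8 * N)) (c (loc (u i)))) a b"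
      using nB uQ[OF ij(1)] unfolding B_def by blast
    have "loc (u k) \<in> cube (real (8 * N)) (c (loc (u i)))" if "min i j \<le> k" "k \<le> max i j" for k
    proof (rule in_cubeI)
      have "infnorm (c (loc (u i)) - loc (u k)) \<le>
          infnorm (c (loc (u i)) - loc (u i)) + infnorm (loc (u i) - loc (u k))"
        using infnorm_triangle[of "c (loc (u i)) - loc (u i)" "loc (u i) - loc (u k)"] by simp
      also have "\<dots> \<le> real N + 2 * real N"
        using c[OF uQ[OF ij(1)]] near[OF that] by (intro add_mono) (auto simp: infnorm_sub)
      also have "\<dots> < real (8 * N) / 2" using N by simp
      finally show "infnorm (c (loc (u i)) - loc (u k)) < real (8 * N) / 2" .
    qed
    then have "a * (?r - b) \<le> \<bar>real j - real i\<bar>"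
      by (intro no_fast_walk_segment[OF w sym no ij]) auto
    moreover have "a' * ?r \<le> a * (?r - b)"
    proof -
      have "b * real N \<le> b * ?r" using far b by (intro mult_left_mono) auto
      then have "b \<le> b / real N * ?r" using N by (simp add: field_simps)
      then have "(1 - b / real N) * ?r \<le> ?r - b" by (simp add: algebra_simps)
      then have "a * ((1 - b / real N) * ?r) \<le> a * (?r - b)" using a(1) by (rule mult_left_mono)
      moreover have "a' * ?r \<le> a * (1 - b / real N) * ?r"
        using a' by (rule mult_right_mono) (rule infnorm_pos_le)
      ultimately show ?thesis by (simp add: mult.assoc)
    qed
    ultimately show "a' * ?r \<le> \<bar>real j - real i\<bar>" by linarith
  next
    fix p q assume pq: "p \<in> B" "q \<in> B"
    then have "infnorm (c p - c q) < 24 * real N"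
      using neg cJ unfolding B_def by (fastforce simp: not_le)
    moreover have "infnorm (p - q) \<le> infnorm (p - c p) + infnorm (c p - c q) + infnorm (q - c q)"
      using infnorm_triangle[of "p - c p" "c p - q"] infnorm_triangle[of "c p - c q" "c q - q"]
        infnorm_sub[of "c q" q] by simp
    ultimately show "infnorm (p - q) \<le> 26 * real N"
      using c[of p] c[of q] pq unfolding B_def by auto
  qed (use a in auto)
  moreover have "a' * (infnorm (loc (u 0) - loc (u l)) - 4 * real (8 * N)) \<le>
      a' * (infnorm (loc (u 0) - loc (u l)) - (26 * real N + real N))"
    using a(2) by (intro mult_left_mono) auto
  ultimately show False using l by linarith
qed

section \<open>Measurability of fast walks\<close>

lemma space_graph_space [simp]: "space (graph_space K) = graph_configs K"
  unfolding graph_space_def Let_def by (rule space_measure_of) auto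

lemma sets_graph_space:
  "sets (graph_space K :: ('d::finite, 'k) graph measure) = sigma_sets (graph_configs K)
    ({{g \<in> graph_configs K. emeasure (count_space UNIV) (verts g \<inter> A) = n} | A n.
        A \<in> sets (borel \<Otimes>\<^sub>M K)} \<union>
     {{g \<in> graph_configs K. emeasure (count_space UNIV) (edges g \<inter> B) = n} | B n.
        B \<in> sets ((borel \<Otimes>\<^sub>M K) \<Otimes>\<^sub>M (borel \<Otimes>\<^sub>M K))})"
  unfolding graph_space_def Let_def by (rule sets_measure_of) auto

lemma count_verts_in_sets:
  assumes "A \<in> sets (borel \<Otimes>\<^sub>M K)"
  shows "{g \<in> graph_configs K. emeasure (count_space UNIV) (verts (g :: ('d::finite, 'k) graph) \<inter> A) = n}
    \<in> sets (graph_space K)"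
  unfolding sets_graph_space using assms by (intro sigma_sets.Basic) blast

lemma count_edges_in_sets:
  assumes "B \<in> sets ((borel \<Otimes>\<^sub>M K) \<Otimes>\<^sub>M (borel \<Otimes>\<^sub>M K))"
  shows "{g \<in> graph_configs K. emeasure (count_space UNIV) (edges (g :: ('d::finite, 'k) graph) \<inter> B) = n}
    \<in> sets (graph_space K)"
  unfolding sets_graph_space using assms by (intro sigma_sets.Basic) blast

text \<open>The generators of the \<open>\<sigma>\<close>-algebra count vertices and edges; only the counts being nonzero matters for walks.\<close>

lemma configs_with_vertex_in_sets:
  assumes "A \<in> sets borel"
  shows "{g \<in> graph_configs K. \<exists>v \<in> verts (g :: ('d::finite, 'k) graph). loc v \<in> A} \<in> sets (graph_space K)"
proof -
  have "A \<times> space K \<in> sets (borel \<Otimes>\<^sub>M K)" using assms by auto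
  from sets.compl_sets[OF count_verts_in_sets[OF this, of 0]]
  have "graph_configs K - {g \<in> graph_configs K.
      emeasure (count_space UNIV) (verts g \<inter> A \<times> space K) = 0} \<in> sets (graph_space K)" by simp
  also have "graph_configs K - {g \<in> graph_configs K.
      emeasure (count_space UNIV) (verts g \<inter> A \<times> space K) = 0} =
      {g \<in> graph_configs K. \<exists>v \<in> verts g. loc v \<in> A}"
  proof (intro set_eqI)
    fix g :: "('d, 'k) graph"
    show "g \<in> graph_configs K - {g \<in> graph_configs K.
          emeasure (count_space UNIV) (verts g \<inter> A \<times> space K) = 0} \<longleftrightarrow>
        g \<in> {g \<in> graph_configs K. \<exists>v \<in> verts g. loc v \<in> A}"
    proof (cases "g \<in> graph_configs K")
      case True
      then have "verts g \<subseteq> UNIV \<times> space K" unfolding graph_configs_def by blast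
      then have "verts g \<inter> A \<times> space K \<noteq> {} \<longleftrightarrow> (\<exists>v \<in> verts g. loc v \<in> A)"
        by (fastforce simp: mem_Times_iff)
      with True show ?thesis by (simp add: emeasure_count_space_eq_0)
    qed simp
  qed
  finally show ?thesis .
qed

lemma configs_with_edge_in_sets:
  assumes "B \<in> sets (borel \<Otimes>\<^sub>M borel)"
  shows "{g \<in> graph_configs K. \<exists>u v. (u, v) \<in> edges (g :: ('d::finite, 'k) graph) \<and> (loc u, loc v) \<in> B}
    \<in> sets (graph_space K)"
proof -
  let ?S = "(borel :: (real^'d) measure) \<Otimes>\<^sub>M K"
  define B' where "B' = (\<lambda>e. (fst (fst e), fst (snd e))) -` B \<inter> space (?S \<Otimes>\<^sub>M ?S)"
  have "B' \<in> sets (?S \<Otimes>\<^sub>M ?S)" unfolding B'_def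
    by (rule measurable_sets[OF _ assms]) measurable
  from sets.compl_sets[OF count_edges_in_sets[OF this, of 0]]
  have "graph_configs K - {g \<in> graph_configs K.
      emeasure (count_space UNIV) (edges g \<inter> B') = 0} \<in> sets (graph_space K)" by simp
  also have "graph_configs K - {g \<in> graph_configs K.
      emeasure (count_space UNIV) (edges g \<inter> B') = 0} =
      {g \<in> graph_configs K. \<exists>u v. (u, v) \<in> edges g \<and> (loc u, loc v) \<in> B}"
  proof (intro set_eqI)
    fix g :: "('d, 'k) graph"
    show "g \<in> graph_configs K - {g \<in> graph_configs K.
          emeasure (count_space UNIV) (edges g \<inter> B') = 0} \<longleftrightarrow>
        g \<in> {g \<in> graph_configs K. \<exists>u v. (u, v) \<in> edges g \<and> (loc u, loc v) \<in> B}"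
    proof (cases "g \<in> graph_configs K")
      case True
      then have "edges g \<subseteq> space (?S \<Otimes>\<^sub>M ?S)"
        unfolding graph_configs_def space_pair_measure space_borel by blast
      then have "edges g \<inter> B' \<noteq> {} \<longleftrightarrow> (\<exists>e \<in> edges g. (loc (fst e), loc (snd e)) \<in> B)"
        unfolding B'_def by blast
      also have "\<dots> \<longleftrightarrow> (\<exists>u v. (u, v) \<in> edges g \<and> (loc u, loc v) \<in> B)"
        by (metis fst_conv snd_conv prod.collapse)
      finally show ?thesis using True by (simp add: emeasure_count_space_eq_0)
    qed simp
  qed
  finally show ?thesis .
qed

lemma borel_coordinate [measurable]: "(\<lambda>x :: real^'d::finite. x $ i) \<in> borel_measurable borel"
  by (intro borel_measurable_continuous_onI continuous_intros)

lemma cube_borel [measurable]: "cube r (x :: real^'d::finite) \<in> sets borel"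
  unfolding cube_def by measurable

lemma bounded_cube: "bounded (cube r (x :: real^'d::finite))"
proof (rule bounded_subset[OF bounded_cbox])
  show "cube r x \<subseteq> cbox (\<chi> i. x $ i - r / 2) (\<chi> i. x $ i + r / 2)"
    unfolding cube_def by (auto simp: cbox_interval less_eq_vec_def less_imp_le)
qed

text \<open>Cells of side \<open>1 / n\<close>, used to identify vertices by their locations through countably many conditions. As the mark
space is arbitrary, the vertices themselves cannot be told apart in a measurable way, but locations are distinct.
For \<open>n = 0\<close> there is only one nonempty cell, which does no harm.\<close>

definition cell :: "nat \<Rightarrow> int^'d::finite \<Rightarrow> (real^'d) set" where
  "cell n c = {x. \<forall>i. \<lfloor>real n * x $ i\<rfloor> = c $ i}"

lemma cell_borel [measurable]: "cell n c \<in> sets borel"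
  unfolding cell_def by measurable

lemma cell_cover: "\<exists>c. x \<in> cell n c"
  unfolding cell_def by (intro exI[of _ "\<chi> i. \<lfloor>real n * x $ i\<rfloor>"]) simp

lemma cells_separate:
  fixes F :: "(real^'d::finite) set"
  assumes "finite F"
  shows "\<exists>n. \<forall>x\<in>F. \<forall>y\<in>F. \<forall>c. x \<in> cell n c \<longrightarrow> y \<in> cell n c \<longrightarrow> x = y"
proof -
  define D where "D = (\<lambda>(x, y). infnorm (x - y)) ` {(x, y) \<in> F \<times> F. x \<noteq> y}"
  have "finite D" unfolding D_def
    by (intro finite_imageI finite_subset[OF _ finite_cartesian_product[OF assms assms]]) auto
  have pos: "\<delta> > 0" if "\<delta> \<in> D" for \<delta> using that unfolding D_def by (auto simp: infnorm_pos_lt)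
  define \<delta> where "\<delta> = Min (insert 1 D)"
  have "\<delta> > 0" using \<open>finite D\<close> pos unfolding \<delta>_def by (auto simp: Min_gr_iff)
  then obtain n :: nat where n: "1 / \<delta> < real n" using reals_Archimedean2 by blast
  with \<open>\<delta> > 0\<close> have n0: "0 < real n" by (meson divide_pos_pos less_trans zero_less_one)
  show ?thesis
  proof (intro exI ballI allI impI, rule ccontr)
    fix x y c assume xy: "x \<in> F" "y \<in> F" "x \<in> cell n c" "y \<in> cell n c" "x \<noteq> y"
    then have "infnorm (x - y) \<in> D" unfolding D_def by auto
    then have "\<delta> \<le> infnorm (x - y)" using \<open>finite D\<close> unfolding \<delta>_def by (auto intro: Min_le)
    moreover have "\<bar>(x - y) $ i\<bar> \<le> 1 / real n" for i
    proof -
      have "\<lfloor>real n * x $ i\<rfloor> = \<lfloor>real n * y $ i\<rfloor>" using xy(3,4) unfolding cell_def by simp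
      then have "\<bar>real n * x $ i - real n * y $ i\<bar> < 1" by linarith
      then have "real n * \<bar>(x - y) $ i\<bar> < 1"
        using n0 by (simp add: abs_mult flip: right_diff_distrib)
      then show ?thesis using n0 by (simp add: field_simps)
    qed
    then have "infnorm (x - y) \<le> 1 / real n" by (simp add: infnorm_le_iff_cart)
    moreover have "1 / real n < \<delta>" using n n0 \<open>\<delta> > 0\<close> by (simp add: field_simps)
    ultimately show False by linarith
  qed
qed

lemma walk_Suc_iff:
  "(\<exists>u. walk g W (Suc l) u \<and> loc (u 0) \<in> A \<and> loc (u (Suc l)) \<in> B) \<longleftrightarrow>
    (\<exists>u v. walk g W l u \<and> loc (u 0) \<in> A \<and> (u l, v) \<in> edges g \<and> v \<in> verts g \<and> loc v \<in> W \<inter> B)"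
proof
  assume "\<exists>u. walk g W (Suc l) u \<and> loc (u 0) \<in> A \<and> loc (u (Suc l)) \<in> B"
  then show "\<exists>u v. walk g W l u \<and> loc (u 0) \<in> A \<and> (u l, v) \<in> edges g \<and> v \<in> verts g \<and> loc v \<in> W \<inter> B"
    unfolding walk_def by (metis IntI le_SucI le_refl less_SucI lessI)
next
  assume "\<exists>u v. walk g W l u \<and> loc (u 0) \<in> A \<and> (u l, v) \<in> edges g \<and> v \<in> verts g \<and> loc v \<in> W \<inter> B"
  then obtain u v where "walk g W l u" "loc (u 0) \<in> A" "(u l, v) \<in> edges g" "v \<in> verts g" "loc v \<in> W \<inter> B"
    by blast
  then show "\<exists>u. walk g W (Suc l) u \<and> loc (u 0) \<in> A \<and> loc (u (Suc l)) \<in> B"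
    by (intro exI[of _ "u(Suc l := v)"]) (auto simp: walk_def le_Suc_eq less_Suc_eq)
qed

text \<open>To append an edge to a walk one has to express that the edge starts where the walk ends. This holds exactly if, for every mesh
width, some cell contains both the endpoint of a walk and the start of an edge: a
configuration has finitely many vertices in the bounded set \<open>W\<close>, so a fine mesh puts them into distinct cells.\<close>

lemma walk_configs_in_sets:
  fixes W :: "(real^'d::finite) set" and K :: "'k measure"
  assumes W: "W \<in> sets borel" "bounded W" and A: "A \<in> sets borel" and "B \<in> sets borel"
  shows "{g \<in> graph_configs K. \<exists>u. walk g W l u \<and> loc (u 0) \<in> A \<and> loc (u l) \<in> B}
    \<in> sets (graph_space K)"
  using assms(4)
proof (induction l arbitrary: B)
  case 0
  have "{g \<in> graph_configs K. \<exists>u. walk g W 0 u \<and> loc (u 0) \<in> A \<and> loc (u 0) \<in> B} =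
      {g \<in> graph_configs K. \<exists>v \<in> verts g. loc v \<in> W \<inter> A \<inter> B}"
  proof (intro set_eqI iffI)
    fix g :: "('d, 'k) graph"
    assume "g \<in> {g \<in> graph_configs K. \<exists>v \<in> verts g. loc v \<in> W \<inter> A \<inter> B}"
    then obtain v where "g \<in> graph_configs K" "v \<in> verts g" "loc v \<in> W \<inter> A \<inter> B" by blast
    then show "g \<in> {g \<in> graph_configs K. \<exists>u. walk g W 0 u \<and> loc (u 0) \<in> A \<and> loc (u 0) \<in> B}"
      by (intro CollectI conjI exI[of _ "\<lambda>_. v"]) (simp_all add: walk_def)
  qed (auto simp: walk_def)
  then show ?case
    using configs_with_vertex_in_sets[of "W \<inter> A \<inter> B" K] 0 W A by simp
next
  case (Suc l)
  let ?X = "\<lambda>n c. {g \<in> graph_configs K. \<exists>u. walk g W l u \<and> loc (u 0) \<in> A \<and> loc (u l) \<in> cell n c}"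
  let ?Y = "\<lambda>n c. {g \<in> graph_configs K. \<exists>u v. (u, v) \<in> edges g \<and>
    (loc u, loc v) \<in> (W \<inter> cell n c) \<times> (W \<inter> B)}"
  have "{g \<in> graph_configs K. \<exists>u. walk g W (Suc l) u \<and> loc (u 0) \<in> A \<and> loc (u (Suc l)) \<in> B} =
      (\<Inter>n. \<Union>c. ?X n c \<inter> ?Y n c)" (is "?L = ?R")
  proof (intro equalityI subsetI)
    fix g assume "g \<in> ?L"
    then obtain u v where g: "g \<in> graph_configs K" and uv: "walk g W l u" "loc (u 0) \<in> A"
      "(u l, v) \<in> edges g" "loc v \<in> W \<inter> B"
      unfolding walk_Suc_iff by blast
    then have "loc (u l) \<in> W" unfolding walk_def by simp
    show "g \<in> ?R"
    proof (rule INT_I)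
      fix n :: nat
      obtain c where c: "loc (u l) \<in> cell n c" using cell_cover by blast
      have "g \<in> ?X n c" using g uv(1,2) c by blast
      moreover have "g \<in> ?Y n c" using g uv(3,4) \<open>loc (u l) \<in> W\<close> c by blast
      ultimately show "g \<in> (\<Union>c. ?X n c \<inter> ?Y n c)" by blast
    qed
  next
    fix g :: "('d, 'k) graph" assume R: "g \<in> ?R"
    then have "g \<in> (\<Union>c. ?X 0 c \<inter> ?Y 0 c)" by (rule INT_D) simp
    then have g: "g \<in> graph_configs K" by blast
    then have "finite (loc ` {v \<in> verts g. loc v \<in> W})"
      using W(2) unfolding graph_configs_def by blast
    from cells_separate[OF this] obtain n where
      n: "\<And>x y c. x \<in> loc ` {v \<in> verts g. loc v \<in> W} \<Longrightarrow> y \<in> loc ` {v \<in> verts g. loc v \<in> W} \<Longrightarrow>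
        x \<in> cell n c \<Longrightarrow> y \<in> cell n c \<Longrightarrow> x = y" by blast
    from R have "g \<in> (\<Union>c. ?X n c \<inter> ?Y n c)" by (rule INT_D) simp
    then obtain c where X: "g \<in> ?X n c" and Y: "g \<in> ?Y n c" by blast
    obtain u where "walk g W l u" "loc (u 0) \<in> A" "loc (u l) \<in> cell n c"
      using X by blast
    moreover obtain v w where "(v, w) \<in> edges g" "loc v \<in> W" "loc v \<in> cell n c" "loc w \<in> W \<inter> B"
      using Y by auto
    ultimately have *: "walk g W l u" "loc (u 0) \<in> A" "loc (u l) \<in> cell n c"
      "(v, w) \<in> edges g" "loc v \<in> W" "loc v \<in> cell n c" "loc w \<in> W \<inter> B" by blast+
    have vw: "v \<in> verts g" "w \<in> verts g" using * g unfolding graph_configs_def by auto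
    have ul: "u l \<in> verts g" "loc (u l) \<in> W" using *(1) unfolding walk_def by auto
    have "loc (u l) = loc v" using ul vw * by (intro n[of _ _ c]) auto
    then have "u l = v" using g ul vw unfolding graph_configs_def by (auto dest: inj_onD)
    then show "g \<in> ?L" unfolding walk_Suc_iff using g * vw by blast
  qed
  moreover have X: "?X n c \<in> sets (graph_space K)" for n c
    by (rule Suc.IH) (rule cell_borel)
  moreover have Y: "?Y n c \<in> sets (graph_space K)" for n c
    by (rule configs_with_edge_in_sets, rule pair_measureI; rule sets.Int)
      (use W Suc.prems cell_borel in auto)
  have "(\<Union>c. ?X n c \<inter> ?Y n c) \<in> sets (graph_space K)" for n
    by (rule sets.countable_UN) (use X Y in \<open>blast intro: sets.Int\<close>)
  then have "?R \<in> sets (graph_space K)"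
    by (intro sets.countable_INT) (simp_all add: image_subset_iff)
  ultimately show ?case by simp
qed

text \<open>A rational threshold \<open>q\<close> between two coordinates decouples the conditions on the two ends of a walk.\<close>

lemma less_infnorm_iff:
  fixes x y :: "real^'d::finite"
  assumes "0 \<le> r"
  shows "r < infnorm (x - y) \<longleftrightarrow>
    (\<exists>i. \<exists>q\<in>\<rat>. r + q < x $ i \<and> y $ i < q \<or> x $ i < q \<and> r + q < y $ i)"
proof -
  have "r < infnorm (x - y) \<longleftrightarrow> (\<exists>i. r < \<bar>x $ i - y $ i\<bar>)"
    using infnorm_le_iff_cart[of "x - y" r] by (simp flip: not_le)
  also have "\<dots> \<longleftrightarrow> (\<exists>i. \<exists>q\<in>\<rat>. r + q < x $ i \<and> y $ i < q \<or> x $ i < q \<and> r + q < y $ i)"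
  proof (rule ex_cong1)
    fix i
    have *: "\<exists>q\<in>\<rat>. r + q < s \<and> t < q" if "r < s - t" for s t
      using Rats_dense_in_real[of t "s - r"] that by (force simp: algebra_simps)
    show "r < \<bar>x $ i - y $ i\<bar> \<longleftrightarrow> (\<exists>q\<in>\<rat>. r + q < x $ i \<and> y $ i < q \<or> x $ i < q \<and> r + q < y $ i)"
      using *[of "x $ i" "y $ i"] *[of "y $ i" "x $ i"] by (auto simp: abs_if)
  qed
  finally show ?thesis .
qed

lemma fast_walk_configs_in_sets:
  fixes W :: "(real^'d::finite) set" and K :: "'k measure"
  assumes W: "W \<in> sets borel" "bounded W" and a: "0 < a" and b: "0 \<le> b"
  shows "{g \<in> graph_configs K. fast_walk g W a b} \<in> sets (graph_space K)"
proof -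
  let ?X = "\<lambda>l i q. {g \<in> graph_configs K. \<exists>u. walk g W l u \<and>
      loc (u 0) \<in> {x. real l / a + b + q < x $ i} \<and> loc (u l) \<in> {x. x $ i < q}}"
  let ?Y = "\<lambda>l i q. {g \<in> graph_configs K. \<exists>u. walk g W l u \<and>
      loc (u 0) \<in> {x. x $ i < q} \<and> loc (u l) \<in> {x. real l / a + b + q < x $ i}}"
  have "fast_walk g W a b \<longleftrightarrow> (\<exists>l i. \<exists>q\<in>\<rat>. \<exists>u. walk g W l u \<and>
      (real l / a + b + q < loc (u 0) $ i \<and> loc (u l) $ i < q \<or>
       loc (u 0) $ i < q \<and> real l / a + b + q < loc (u l) $ i))" for g :: "('d, 'k) graph"
  proof -
    have "real l < a * (infnorm z - b) \<longleftrightarrow> real l / a + b < infnorm z" for l and z :: "real^'d"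
      using a by (simp add: field_simps)
    then have "fast_walk g W a b \<longleftrightarrow>
        (\<exists>l u. walk g W l u \<and> real l / a + b < infnorm (loc (u 0) - loc (u l)))"
      unfolding fast_walk_def by simp
    then show ?thesis using less_infnorm_iff[of "real l / a + b" for l] a b by simp blast
  qed
  then have "{g \<in> graph_configs K. fast_walk g W a b} =
      (\<Union>l. \<Union>i. \<Union>q\<in>\<rat>. ?X l i q \<union> ?Y l i q)" by (simp add: Collect_disj_eq) blast
  moreover have "?X l i q \<in> sets (graph_space K)" for l i q
    by (rule walk_configs_in_sets[OF W]) measurable
  moreover have "?Y l i q \<in> sets (graph_space K)" for l i q
    by (rule walk_configs_in_sets[OF W]) measurable
  ultimately show ?thesis
    by (auto intro!: sets.countable_UN' sets.Un countable_rat)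
qed

section \<open>Restrictions and translations of configurations\<close>

text \<open>Counts of vertices and of edges generate the \<open>\<sigma>\<close>-algebra, so a map of configurations is measurable once
the counts of the image are counts of the original configuration.\<close>

lemma measurable_graph_map:
  fixes f :: "('d::finite, 'k) graph \<Rightarrow> ('d, 'k) graph" and K :: "'k measure"
  assumes f: "\<And>g. g \<in> graph_configs K \<Longrightarrow> f g \<in> graph_configs K"
    and V: "\<And>A. A \<in> sets (borel \<Otimes>\<^sub>M K) \<Longrightarrow> \<exists>A' \<in> sets (borel \<Otimes>\<^sub>M K). \<forall>g \<in> graph_configs K.
      emeasure (count_space UNIV) (verts (f g) \<inter> A) = emeasure (count_space UNIV) (verts g \<inter> A')"
    and E: "\<And>B. B \<in> sets ((borel \<Otimes>\<^sub>M K) \<Otimes>\<^sub>M (borel \<Otimes>\<^sub>M K)) \<Longrightarrow>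
      \<exists>B' \<in> sets ((borel \<Otimes>\<^sub>M K) \<Otimes>\<^sub>M (borel \<Otimes>\<^sub>M K)). \<forall>g \<in> graph_configs K.
      emeasure (count_space UNIV) (edges (f g) \<inter> B) = emeasure (count_space UNIV) (edges g \<inter> B')"
  shows "f \<in> measurable (graph_space K) (graph_space K)"
proof (rule measurable_sigma_sets[OF sets_graph_space])
  fix Y :: "('d, 'k) graph set"
  assume "Y \<in> {{g \<in> graph_configs K. emeasure (count_space UNIV) (verts g \<inter> A) = n} | A n.
        A \<in> sets (borel \<Otimes>\<^sub>M K)} \<union>
     {{g \<in> graph_configs K. emeasure (count_space UNIV) (edges g \<inter> B) = n} | B n.
        B \<in> sets ((borel \<Otimes>\<^sub>M K) \<Otimes>\<^sub>M (borel \<Otimes>\<^sub>M K))}"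
  then consider A n where "A \<in> sets (borel \<Otimes>\<^sub>M K)"
      "Y = {g \<in> graph_configs K. emeasure (count_space UNIV) (verts g \<inter> A) = n}"
    | B n where "B \<in> sets ((borel \<Otimes>\<^sub>M K) \<Otimes>\<^sub>M (borel \<Otimes>\<^sub>M K))"
      "Y = {g \<in> graph_configs K. emeasure (count_space UNIV) (edges g \<inter> B) = n}"
    by blast
  then show "f -` Y \<inter> space (graph_space K) \<in> sets (graph_space K)"
  proof cases
    case 1
    obtain A' where A': "A' \<in> sets (borel \<Otimes>\<^sub>M K)" "\<And>g. g \<in> graph_configs K \<Longrightarrow>
      emeasure (count_space UNIV) (verts (f g) \<inter> A) = emeasure (count_space UNIV) (verts g \<inter> A')"
      using V[OF 1(1)] by blast
    have "f -` Y \<inter> space (graph_space K) =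
        {g \<in> graph_configs K. emeasure (count_space UNIV) (verts g \<inter> A') = n}"
      using f A'(2) unfolding 1(2) space_graph_space by auto
    then show ?thesis using count_verts_in_sets[OF A'(1)] by simp
  next
    case 2
    obtain B' where B': "B' \<in> sets ((borel \<Otimes>\<^sub>M K) \<Otimes>\<^sub>M (borel \<Otimes>\<^sub>M K))" "\<And>g. g \<in> graph_configs K \<Longrightarrow>
      emeasure (count_space UNIV) (edges (f g) \<inter> B) = emeasure (count_space UNIV) (edges g \<inter> B')"
      using E[OF 2(1)] by blast
    have "f -` Y \<inter> space (graph_space K) =
        {g \<in> graph_configs K. emeasure (count_space UNIV) (edges g \<inter> B') = n}"
      using f B'(2) unfolding 2(2) space_graph_space by auto
    then show ?thesis using count_edges_in_sets[OF B'(1)] by simp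
  qed
qed (use f in auto)

lemma restrict_graph_configs:
  assumes "g \<in> graph_configs K"
  shows "restrict_graph A g \<in> graph_configs K"
proof -
  have "finite {v \<in> {v \<in> verts g. loc v \<in> A}. loc v \<in> X}" if "bounded X" for X
    using assms that unfolding graph_configs_def by (auto intro: finite_subset[of _ "{v \<in> verts g. loc v \<in> X}"])
  moreover have "sym (edges g \<inter> {v \<in> verts g. loc v \<in> A} \<times> {v \<in> verts g. loc v \<in> A})"
    using assms unfolding graph_configs_def by (auto intro!: symI dest: symD)
  ultimately show ?thesis
    using assms unfolding graph_configs_def restrict_graph_def Let_def
    by (auto intro: inj_on_subset simp: irrefl_def)
qed

lemma measurable_restrict_graph:
  assumes "A \<in> sets borel"
  shows "restrict_graph A \<in> measurable (graph_space K) (graph_space K :: ('d::finite, 'k) graph measure)"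
proof (rule measurable_graph_map)
  have A: "A \<times> space K \<in> sets (borel \<Otimes>\<^sub>M K)" using assms by auto
  fix X assume X: "X \<in> sets ((borel :: (real^'d) measure) \<Otimes>\<^sub>M K)"
  have "verts (restrict_graph A g) \<inter> X = verts g \<inter> (X \<inter> A \<times> space K)" for g
    using sets.sets_into_space[OF X] unfolding restrict_graph_def Let_def
    by (auto simp: space_pair_measure)
  then show "\<exists>A' \<in> sets (borel \<Otimes>\<^sub>M K). \<forall>g \<in> graph_configs K.
      emeasure (count_space UNIV) (verts (restrict_graph A g) \<inter> X) =
      emeasure (count_space UNIV) (verts g \<inter> A')"
    using X A by (intro bexI[of _ "X \<inter> A \<times> space K"]) auto
next
  have A: "A \<times> space K \<in> sets (borel \<Otimes>\<^sub>M K)" using assms by auto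
  let ?A = "(A \<times> space K) \<times> (A \<times> space K)"
  fix X assume X: "X \<in> sets (((borel :: (real^'d) measure) \<Otimes>\<^sub>M K) \<Otimes>\<^sub>M ((borel :: (real^'d) measure) \<Otimes>\<^sub>M K))"
  have "edges (restrict_graph A g) \<inter> X = edges g \<inter> (X \<inter> ?A)" if "g \<in> graph_configs K" for g
    using sets.sets_into_space[OF X] that unfolding restrict_graph_def Let_def graph_configs_def
    by (auto simp: space_pair_measure)
  then show "\<exists>B' \<in> sets ((borel \<Otimes>\<^sub>M K) \<Otimes>\<^sub>M (borel \<Otimes>\<^sub>M K)). \<forall>g \<in> graph_configs K.
      emeasure (count_space UNIV) (edges (restrict_graph A g) \<inter> X) =
      emeasure (count_space UNIV) (edges g \<inter> B')"
    using X A by (intro bexI[of _ "X \<inter> ?A"]) auto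
qed (rule restrict_graph_configs)

text \<open>A walk inside \<open>W\<close> sees only the subgraph induced by \<open>W\<close>; this is what makes fast walks local.\<close>

lemma walk_restrict_graph [simp]: "walk (restrict_graph W g) W l u \<longleftrightarrow> walk g W l u"
  unfolding walk_def restrict_graph_def Let_def by auto

lemma fast_walk_restrict_graph [simp]: "fast_walk (restrict_graph W g) W a b \<longleftrightarrow> fast_walk g W a b"
  unfolding fast_walk_def by simp

abbreviation shift_vertex :: "real^'d::finite \<Rightarrow> ('d, 'k) vertex \<Rightarrow> ('d, 'k) vertex" where
  "shift_vertex t v \<equiv> (loc v + t, snd v)"

lemma inj_shift_vertex: "inj (shift_vertex t)"
  by (rule injI) (auto simp: prod_eq_iff)

lemma verts_shift: "verts (shift t g) = shift_vertex t ` verts g"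
  and edges_shift: "edges (shift t g) = map_prod (shift_vertex t) (shift_vertex t) ` edges g"
  unfolding shift_def Let_def by auto

lemma shift_shift: "shift s (shift t g) = shift (t + s) g"
  by (rule prod_eqI) (auto simp: verts_shift edges_shift image_image add.assoc map_prod_def case_prod_beta)

lemma shift_0 [simp]: "shift 0 g = g"
  by (rule prod_eqI) (auto simp: verts_shift edges_shift map_prod_def case_prod_beta)

lemma shift_graph_configs:
  fixes g :: "('d::finite, 'k) graph"
  assumes g: "g \<in> graph_configs K"
  shows "shift t g \<in> graph_configs K"
  unfolding graph_configs_def
proof (intro CollectI conjI allI impI)
  show "verts (shift t g) \<subseteq> UNIV \<times> space K" "edges (shift t g) \<subseteq> verts (shift t g) \<times> verts (shift t g)"
    using g unfolding graph_configs_def verts_shift edges_shift by (auto simp: mem_Times_iff)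
  show "inj_on loc (verts (shift t g))"
    using g unfolding graph_configs_def verts_shift by (auto simp: inj_on_def)
  show "sym (edges (shift t g))"
  proof (rule symI)
    fix a b assume "(a, b) \<in> edges (shift t g)"
    then obtain u v where uv: "a = shift_vertex t u" "b = shift_vertex t v" "(u, v) \<in> edges g"
      unfolding edges_shift by auto
    have "sym (edges g)" using g unfolding graph_configs_def by blast
    then have "(v, u) \<in> edges g" using uv(3) by (rule symD)
    then have "map_prod (shift_vertex t) (shift_vertex t) (v, u) \<in> edges (shift t g)"
      unfolding edges_shift by (rule imageI)
    then show "(b, a) \<in> edges (shift t g)" using uv by simp
  qed
  have "u \<noteq> v" if "(u, v) \<in> edges g" for u v
    using that g unfolding graph_configs_def irrefl_def by blast
  then have "shift_vertex t u \<noteq> shift_vertex t v" if "(u, v) \<in> edges g" for u v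
    using that inj_eq[OF inj_shift_vertex[of t], of u v] by blast
  then show "irrefl (edges (shift t g))"
    unfolding edges_shift irrefl_def by fastforce
  fix A :: "(real^'d) set" assume "bounded A"
  then have "bounded ((+) (- t) ` A)" by (rule bounded_translation)
  then have "finite (shift_vertex t ` {v \<in> verts g. loc v \<in> (+) (- t) ` A})"
    using g unfolding graph_configs_def by blast
  moreover have "{v \<in> verts (shift t g). loc v \<in> A} \<subseteq>
      shift_vertex t ` {v \<in> verts g. loc v \<in> (+) (- t) ` A}"
    unfolding verts_shift by (force simp: image_iff)
  ultimately show "finite {v \<in> verts (shift t g). loc v \<in> A}" by (rule rev_finite_subset)
qed

lemma image_Int_eq_image_vimage: "A \<subseteq> S \<Longrightarrow> f ` A \<inter> X = f ` (A \<inter> (f -` X \<inter> S))"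
  by blast

lemma emeasure_count_space_inj_image:
  "inj f \<Longrightarrow> emeasure (count_space UNIV) (f ` X) = emeasure (count_space UNIV) X"
  by (simp add: emeasure_count_space finite_image_iff inj_on_subset[of f UNIV] card_image)

lemma measurable_shift:
  "shift t \<in> measurable (graph_space K) (graph_space K :: ('d::finite, 'k) graph measure)"
proof (rule measurable_graph_map)
  let ?S = "(borel :: (real^'d) measure) \<Otimes>\<^sub>M K"
  have meas [measurable]: "shift_vertex t \<in> measurable ?S ?S" by measurable
  fix X assume X: "X \<in> sets ?S"
  have "emeasure (count_space UNIV) (verts (shift t g) \<inter> X) =
      emeasure (count_space UNIV) (verts g \<inter> (shift_vertex t -` X \<inter> space ?S))"
    if "g \<in> graph_configs K" for g
  proof -
    have "verts g \<subseteq> space ?S" using that unfolding graph_configs_def space_pair_measure by simp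
    then have "verts (shift t g) \<inter> X = shift_vertex t ` (verts g \<inter> (shift_vertex t -` X \<inter> space ?S))"
      unfolding verts_shift by (rule image_Int_eq_image_vimage)
    then show ?thesis by (simp only: emeasure_count_space_inj_image[OF inj_shift_vertex])
  qed
  then show "\<exists>A' \<in> sets (borel \<Otimes>\<^sub>M K). \<forall>g \<in> graph_configs K.
      emeasure (count_space UNIV) (verts (shift t g) \<inter> X) =
      emeasure (count_space UNIV) (verts g \<inter> A')"
    using measurable_sets[OF meas X] by blast
next
  let ?S = "(borel :: (real^'d) measure) \<Otimes>\<^sub>M K"
  let ?s = "map_prod (shift_vertex t) (shift_vertex t) :: ('d, 'k) vertex \<times> ('d, 'k) vertex \<Rightarrow> _"
  have meas: "?s \<in> measurable (?S \<Otimes>\<^sub>M ?S) (?S \<Otimes>\<^sub>M ?S)"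
    unfolding map_prod_def case_prod_beta by measurable
  have inj: "inj ?s" by (rule prod.inj_map) (rule inj_shift_vertex)+
  fix X assume X: "X \<in> sets (?S \<Otimes>\<^sub>M ?S)"
  have "emeasure (count_space UNIV) (edges (shift t g) \<inter> X) =
      emeasure (count_space UNIV) (edges g \<inter> (?s -` X \<inter> space (?S \<Otimes>\<^sub>M ?S)))"
    if "g \<in> graph_configs K" for g
  proof -
    have "edges g \<subseteq> space (?S \<Otimes>\<^sub>M ?S)"
      using that unfolding graph_configs_def space_pair_measure space_borel by blast
    then have "edges (shift t g) \<inter> X = ?s ` (edges g \<inter> (?s -` X \<inter> space (?S \<Otimes>\<^sub>M ?S)))"
      unfolding edges_shift by (rule image_Int_eq_image_vimage)
    then show ?thesis by (simp only: emeasure_count_space_inj_image[OF inj])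
  qed
  then show "\<exists>B' \<in> sets (?S \<Otimes>\<^sub>M ?S). \<forall>g \<in> graph_configs K.
      emeasure (count_space UNIV) (edges (shift t g) \<inter> X) =
      emeasure (count_space UNIV) (edges g \<inter> B')"
    using measurable_sets[OF meas X] by blast
qed (rule shift_graph_configs)

lemma shift_vertex_in_cube: "loc (shift_vertex t v) \<in> cube r (x + t) \<longleftrightarrow> loc v \<in> cube r x"
  unfolding cube_def by (simp add: algebra_simps)

lemma fast_walk_shiftI:
  assumes "fast_walk g (cube r x) a b"
  shows "fast_walk (shift t g) (cube r (x + t)) a b"
proof -
  obtain l u where w: "walk g (cube r x) l u" "real l < a * (infnorm (loc (u 0) - loc (u l)) - b)"
    using assms unfolding fast_walk_def by blast
  have "walk (shift t g) (cube r (x + t)) l (\<lambda>i. shift_vertex t (u i))"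
    using w(1) unfolding walk_def verts_shift edges_shift shift_vertex_in_cube by force
  then show ?thesis using w(2) unfolding fast_walk_def by fastforce
qed

lemma fast_walk_shift: "fast_walk (shift (- y) g) (cube r 0) a b \<longleftrightarrow> fast_walk g (cube r y) a b"
  using fast_walk_shiftI[of g r y a b "- y"] fast_walk_shiftI[of "shift (- y) g" r 0 a b y]
  by (auto simp: shift_shift)

definition fast_configs :: "'k measure \<Rightarrow> real \<Rightarrow> real \<Rightarrow> nat \<Rightarrow> ('d::finite, 'k) graph set" where
  "fast_configs K a b m = {g \<in> graph_configs K. fast_walk g (cube (real m) 0) a b}"

lemma fast_configs_in_sets:
  "0 < a \<Longrightarrow> 0 \<le> b \<Longrightarrow> fast_configs K a b m \<in> sets (graph_space K)"
  unfolding fast_configs_def by (rule fast_walk_configs_in_sets[OF cube_borel bounded_cube])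

section \<open>Covariances and uniform mixing\<close>

lemma setdist_cubes_ge:
  fixes z :: "real^'d::finite"
  assumes r: "0 < r" and z: "3 * r \<le> infnorm z"
  shows "r \<le> setdist (cube r 0) (cube r z)"
proof (rule le_setdistI)
  have "\<not> infnorm z \<le> 5 / 2 * r" using r z by linarith
  then obtain i where i: "5 / 2 * r < \<bar>z $ i\<bar>"
    unfolding infnorm_le_iff_cart by (auto simp: not_le)
  fix x y :: "real^'d" assume "x \<in> cube r 0" "y \<in> cube r z"
  then have "- (r / 2) \<le> x $ i" "x $ i < r / 2" "z $ i - r / 2 \<le> y $ i" "y $ i < z $ i + r / 2"
    unfolding cube_def by auto
  then have "r \<le> \<bar>(x - y) $ i\<bar>" using i by (simp add: abs_if split: if_splits)
  also have "\<dots> \<le> norm (x - y)" by (rule component_le_norm_cart)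
  finally show "r \<le> dist x y" by (simp add: dist_norm)
next
  have "x \<in> cube r x" for x :: "real^'d" using r unfolding cube_def by simp
  then show "cube r (0 :: real^'d) \<noteq> {}" "cube r z \<noteq> {}" by blast+
qed


context random_spatial_graph
begin

lemma G_configs: "\<omega> \<in> space M \<Longrightarrow> G \<omega> \<in> graph_configs K"
  using measurable_space[OF random_graph] by simp

lemma integer_lattice_subset: "integer_lattice \<subseteq> T"
  using continuum_or_lattice by auto

lemma event_at_eq_vimage: "event_at M G E m y = (\<lambda>\<omega>. shift (- y) (G \<omega>)) -` E m \<inter> space M"
  unfolding event_at_def by auto

lemma event_at_in_events:
  assumes "E m \<in> sets (graph_space K)"
  shows "event_at M G E m y \<in> events"
  unfolding event_at_eq_vimage
  by (rule measurable_sets[OF measurable_compose[OF random_graph measurable_shift] assms])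

lemma event_at_fast_configs:
  "event_at M G (fast_configs K a b) m y = {\<omega> \<in> space M. fast_walk (G \<omega>) (cube (real m) y) a b}"
  unfolding event_at_def fast_configs_def
  by (auto simp: fast_walk_shift intro: shift_graph_configs G_configs)

text \<open>Mixing compares a box with the one at the origin; translation invariance transfers it to any two boxes.\<close>

lemma prob_event_at_translate:
  assumes E: "E m \<in> sets (graph_space K)" and y: "y \<in> integer_lattice"
  shows "prob (event_at M G E m y \<inter> event_at M G E m z) =
    prob (event_at M G E m 0 \<inter> event_at M G E m (z - y))"
proof -
  define X where "X = E m \<inter> (shift (- (z - y)) -` E m \<inter> space (graph_space K))"
  have X: "X \<in> sets (graph_space K)"
    unfolding X_def using E by (intro sets.Int measurable_sets[OF measurable_shift]) auto
  have "- y \<in> T" using y integer_lattice_subset unfolding integer_lattice_def by auto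
  have "prob (event_at M G E m y \<inter> event_at M G E m z) =
      prob ((\<lambda>\<omega>. shift (- y) (G \<omega>)) -` X \<inter> space M)"
  proof (intro arg_cong[where f = prob] set_eqI)
    fix \<omega>
    show "\<omega> \<in> event_at M G E m y \<inter> event_at M G E m z \<longleftrightarrow> \<omega> \<in> (\<lambda>\<omega>. shift (- y) (G \<omega>)) -` X \<inter> space M"
      unfolding event_at_eq_vimage X_def
      by (cases "\<omega> \<in> space M") (simp_all add: shift_shift shift_graph_configs G_configs)
  qed
  also have "\<dots> = measure (distr M (graph_space K) (\<lambda>\<omega>. shift (- y) (G \<omega>))) X"
    by (rule measure_distr[symmetric, OF measurable_compose[OF random_graph measurable_shift] X])
  also have "\<dots> = measure (distr M (graph_space K) G) X"
    using translation_invariant[OF \<open>- y \<in> T\<close>] by simp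
  also have "\<dots> = prob (G -` X \<inter> space M)"
    by (rule measure_distr[OF random_graph X])
  also have "G -` X \<inter> space M = event_at M G E m 0 \<inter> event_at M G E m (z - y)"
    unfolding event_at_eq_vimage X_def by (auto intro: G_configs)
  finally show ?thesis .
qed

lemma covariance_indicator:
  assumes "A \<in> events" "B \<in> events"
  shows "covariance M (indicator A) (indicator B) = prob (A \<inter> B) - prob A * prob B"
proof -
  have "covariance M (indicator A) (indicator B) = (\<integral>\<omega>. indicator (A \<inter> B) \<omega> - prob B * indicator A \<omega>
      - prob A * indicator B \<omega> + prob A * prob B \<partial>M)"
    unfolding covariance_def using assms
    by (intro Bochner_Integration.integral_cong)
      (auto simp: indicator_inter_arith algebra_simps)
  also have "\<dots> = prob (A \<inter> B) - prob A * prob B"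
    using assms by (simp add: prob_space integrable_real_indicator less_top[symmetric])
  finally show ?thesis .
qed

text \<open>The subgraph induced by the box decides the event, which therefore belongs to the \<open>\<sigma>\<close>-algebra that is
conditioned on, and its conditional probability is its own indicator.\<close>

lemma local_fast_configs:
  assumes "0 < a" "0 \<le> b"
  shows "local_event M K G (fast_configs K a b)"
  unfolding local_event_def
proof (intro allI conjI)
  fix m
  show sets: "fast_configs K a b m \<in> sets (graph_space K :: ('d, 'k) graph measure)"
    by (rule fast_configs_in_sets[OF assms])
  let ?Q = "cube (real m) 0 :: (real^'d) set"
  let ?F = "sigma_restrict M K G ?Q"
  let ?A = "event_at M G (fast_configs K a b) m 0"
  have restr: "(\<lambda>\<omega>. restrict_graph ?Q (G \<omega>)) \<in> measurable M (graph_space K)"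
    by (rule measurable_compose[OF random_graph measurable_restrict_graph[OF cube_borel]])
  have "subalgebra M ?F"
    unfolding subalgebra_def sigma_restrict_def
  proof
    show "sets (vimage_algebra (space M) (\<lambda>\<omega>. restrict_graph ?Q (G \<omega>)) (graph_space K)) \<subseteq> events"
      unfolding sets_vimage_algebra
      by (rule sets.sigma_sets_subset) (use measurable_sets[OF restr] in auto)
  qed simp
  then interpret finite_measure_subalgebra M ?F by unfold_locales
  have "?A = (\<lambda>\<omega>. restrict_graph ?Q (G \<omega>)) -` fast_configs K a b m \<inter> space M"
    unfolding event_at_fast_configs fast_configs_def by (auto intro: restrict_graph_configs G_configs)
  then have "?A \<in> sets ?F"
    unfolding sigma_restrict_def using in_vimage_algebra[OF sets] by simp
  then have "AE \<omega> in M. real_cond_exp M ?F (indicator ?A) \<omega> = indicator ?A \<omega>"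
    using event_at_in_events[where E = "fast_configs K a b", OF sets]
    by (intro real_cond_exp_F_meas borel_measurable_indicator) (auto simp: less_top[symmetric])
  then show "AE \<omega> in M. real_cond_exp M ?F (indicator ?A) \<omega> \<in> {0, 1}"
    by eventually_elim (auto simp: indicator_def)
qed

text \<open>For each box size \<open>m\<close> take a local event whose largest covariance is within \<open>m powr \<xi>\<close> of the supremum over all local
events. Locality is a condition on each size separately, so these choices form
one local event. Its mixing constant, increased by 1, works for every local event, with a common threshold for \<open>m\<close>.
The condition on \<open>z\<close> is the form of the distance condition that grid points satisfy.\<close>

lemma uniform_mixing:
  assumes mix: "polynomially_mixing M K T G \<xi>"
  shows "\<exists>C > 0. \<forall>\<^sub>F m in sequentially. \<forall>E z. local_event M K G E \<longrightarrow> z \<in> T \<longrightarrow>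
    3 * real m \<le> infnorm z \<longrightarrow>
    covariance M (indicator (event_at M G E m 0)) (indicator (event_at M G E m z)) \<le> C * real m powr \<xi>"
proof -
  let ?cov = "\<lambda>E m z. covariance M (indicator (event_at M G E m 0)) (indicator (event_at M G E m z))"
  let ?far = "\<lambda>m z. z \<in> T \<and> 3 * real m \<le> infnorm z"
  have "local_event M K G (fast_configs K 1 0)" by (rule local_fast_configs) auto
  \<comment> \<open>If no admissible \<open>z\<close> exists for this \<open>m\<close>, any local event serves.\<close>
  have "\<exists>E0. local_event M K G E0 \<and> (\<forall>E z. local_event M K G E \<longrightarrow> ?far m z \<longrightarrow>
      (\<exists>z0. ?far m z0 \<and> ?cov E m z \<le> ?cov E0 m z0 + real m powr \<xi>))" if m: "0 < m" for m
  proof (cases "\<exists>z. ?far m z")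
    case False
    then show ?thesis using local_fast_configs[of 1 0] by (intro exI[of _ "fast_configs K 1 0"]) auto
  next
    case True
    \<comment> \<open>Covariances are bounded by 1, so the supremum over all local events exists.\<close>
    define S where "S = {?cov E m z | E z. local_event M K G E \<and> ?far m z}"
    have "S \<noteq> {}" using True local_fast_configs[of 1 0] unfolding S_def by fastforce
    have "?cov E m z \<le> 1" if "local_event M K G E" for E z
    proof -
      have "E m \<in> sets (graph_space K)" using that unfolding local_event_def by blast
      then have "?cov E m z = prob (event_at M G E m 0 \<inter> event_at M G E m z) -
          prob (event_at M G E m 0) * prob (event_at M G E m z)"
        by (intro covariance_indicator event_at_in_events)
      also have "\<dots> \<le> 1 - 0" by (intro diff_mono prob_le_1) simp
      finally show ?thesis by simp
    qed
    then have bdd: "bdd_above S" unfolding S_def by (intro bdd_aboveI[of _ 1]) auto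
    have "Sup S - real m powr \<xi> < Sup S" using m by simp
    from less_cSupD[OF \<open>S \<noteq> {}\<close> this] obtain E0 z0 where E0: "local_event M K G E0" "?far m z0"
      "Sup S - real m powr \<xi> < ?cov E0 m z0" unfolding S_def by blast
    show ?thesis
    proof (intro exI[of _ E0] conjI allI impI)
      fix E z assume "local_event M K G E" "?far m z"
      then have "?cov E m z \<in> S" unfolding S_def by blast
      then have "?cov E m z \<le> Sup S" using bdd by (rule cSup_upper)
      then show "\<exists>z0. ?far m z0 \<and> ?cov E m z \<le> ?cov E0 m z0 + real m powr \<xi>"
        using E0 by (intro exI[of _ z0]) auto
    qed (rule E0)
  qed
  then have "\<forall>m. \<exists>E0. local_event M K G E0 \<and> (0 < m \<longrightarrow> (\<forall>E z. local_event M K G E \<longrightarrow> ?far m z \<longrightarrow>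
      (\<exists>z0. ?far m z0 \<and> ?cov E m z \<le> ?cov E0 m z0 + real m powr \<xi>)))"
    using \<open>local_event M K G (fast_configs K 1 0)\<close> by blast
  from choice[OF this] obtain E0 where E0: "\<And>m. local_event M K G (E0 m)"
    "\<And>m E z. 0 < m \<Longrightarrow> local_event M K G E \<Longrightarrow> ?far m z \<Longrightarrow>
      \<exists>z0. ?far m z0 \<and> ?cov E m z \<le> ?cov (E0 m) m z0 + real m powr \<xi>" by blast
  define D where "D m = E0 m m" for m
  have D: "event_at M G D m z = event_at M G (E0 m) m z" for m z
    unfolding event_at_def D_def ..
  have "local_event M K G D"
    using E0(1) unfolding local_event_def D unfolding D_def by blast
  then obtain C where C: "C > 0" and ev: "\<forall>\<^sub>F m in sequentially. \<forall>x. norm x > 2 \<and> real m *\<^sub>R x \<in> T \<and>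
          setdist (cube (real m) 0) (cube (real m) (real m *\<^sub>R x)) \<ge> real m \<longrightarrow>
          ?cov D m (real m *\<^sub>R x) \<le> C * real m powr \<xi>"
    using mix unfolding polynomially_mixing_def by blast
  have "\<forall>\<^sub>F m in sequentially. \<forall>E z. local_event M K G E \<longrightarrow> z \<in> T \<longrightarrow>
    3 * real m \<le> infnorm z \<longrightarrow> ?cov E m z \<le> (C + 1) * real m powr \<xi>"
    using ev eventually_gt_at_top[of 0]
  proof eventually_elim
    case (elim m)
    show ?case
    proof (intro allI impI)
      fix E z assume "local_event M K G E" "z \<in> T" "3 * real m \<le> infnorm z"
      then obtain z0 where z0: "z0 \<in> T" "3 * real m \<le> infnorm z0"
        "?cov E m z \<le> ?cov D m z0 + real m powr \<xi>"
        using E0(2)[OF elim(2)] unfolding D by blast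
      \<comment> \<open>The hypothesis parametrises the second box by \<open>z0 / m\<close>.\<close>
      define x where "x = (1 / real m) *\<^sub>R z0"
      have x: "real m *\<^sub>R x = z0" using elim(2) by (simp add: x_def)
      have "3 \<le> infnorm x" using z0(2) elim(2) by (simp add: x_def infnorm_mul field_simps)
      then have "2 < norm x" using infnorm_le_norm[of x] by linarith
      moreover have "real m \<le> setdist (cube (real m) 0) (cube (real m) z0)"
        using elim(2) z0(2) by (intro setdist_cubes_ge) auto
      ultimately have "?cov D m z0 \<le> C * real m powr \<xi>"
        using elim(1) z0(1) x by metis
      then show "?cov E m z \<le> (C + 1) * real m powr \<xi>"
        using z0(3) by (simp add: algebra_simps)
    qed
  qed
  then show ?thesis using C by (intro exI[of _ "C + 1"]) auto
qed

end

section \<open>The probability recursion\<close>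

context random_spatial_graph
begin

lemma edge_length_le:
  assumes "\<omega> \<in> space M" "\<omega> \<notin> long_edge_event M G m n" "(u, v) \<in> edges (G \<omega>)"
    "loc u \<in> cube (real m) 0" "loc v \<in> cube (real m) 0"
  shows "norm (loc u - loc v) \<le> real n"
proof (rule ccontr)
  assume "\<not> norm (loc u - loc v) \<le> real n"
  then have "real n < norm (loc u - loc v)" by simp
  with assms show False unfolding long_edge_event_def by blast
qed

lemma long_edge_event_in_events: "long_edge_event M G m n \<in> events"
proof -
  let ?Q = "cube (real m) 0 :: (real^'d) set"
  let ?B = "{p. fst p \<in> ?Q \<and> snd p \<in> ?Q \<and> real n < norm (fst p - snd p)}"
  have "{p \<in> space (borel \<Otimes>\<^sub>M borel). fst p \<in> ?Q \<and> snd p \<in> ?Q \<and> real n < norm (fst p - snd p)}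
      \<in> sets ((borel :: (real^'d) measure) \<Otimes>\<^sub>M borel)"
    by measurable
  then have "?B \<in> sets ((borel :: (real^'d) measure) \<Otimes>\<^sub>M borel)"
    by (simp add: space_pair_measure)
  from measurable_sets[OF random_graph configs_with_edge_in_sets[OF this]]
  have "G -` {g \<in> graph_configs K. \<exists>u v. (u, v) \<in> edges g \<and> (loc u, loc v) \<in> ?B} \<inter> space M \<in> events" .
  also have "G -` {g \<in> graph_configs K. \<exists>u v. (u, v) \<in> edges g \<and> (loc u, loc v) \<in> ?B} \<inter> space M =
      long_edge_event M G m n"
    unfolding long_edge_event_def using G_configs by auto
  finally show ?thesis .
qed

text \<open>Union bound over the long edges and over the pairs of distant fast boxes. By mixing each pair
has probability at most the square of the probability of a single box, up to \<open>\<kappa>\<close>.\<close>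

lemma prob_fast_walk_step:
  assumes N: "0 < N" and a: "0 < a" "0 < a'" and b: "0 \<le> b" and a': "a' \<le> a * (1 - b / real N)"
    and mix: "\<And>z. z \<in> T \<Longrightarrow> 3 * real (8 * N) \<le> infnorm z \<Longrightarrow>
      covariance M (indicator (event_at M G (fast_configs K a b) (8 * N) 0))
        (indicator (event_at M G (fast_configs K a b) (8 * N) z)) \<le> \<kappa>" and \<kappa>: "0 \<le> \<kappa>"
  shows "prob (event_at M G (fast_configs K a' (4 * real (8 * N))) (8 * N * C) 0) \<le>
    prob (long_edge_event M G (8 * N * C) N) +
    real ((4 * C + 1) ^ (2 * CARD('d))) *
      ((prob (event_at M G (fast_configs K a b) (8 * N) 0))\<^sup>2 + \<kappa>)"
proof -
  let ?J = "grid (2 * N) (2 * C) :: (real^'d) set"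
  define A where "A w = event_at M G (fast_configs K a b) (8 * N) w" for w
  define P where "P = {(w, w'). w \<in> ?J \<and> w' \<in> ?J \<and> 3 * real (8 * N) \<le> infnorm (w' - w)}"
  have E: "fast_configs K a b (8 * N) \<in> sets (graph_space K :: ('d, 'k) graph measure)"
    using a b by (intro fast_configs_in_sets)
  have A: "A w \<in> events" for w
    unfolding A_def by (rule event_at_in_events[where E = "fast_configs K a b", OF E])
  have J: "w' - w \<in> integer_lattice" if "w \<in> ?J" "w' \<in> ?J" for w w'
  proof -
    have "w \<in> integer_lattice" "w' \<in> integer_lattice" using that grid_lattice by auto
    then show ?thesis unfolding integer_lattice_def by simp
  qed
  have far: "prob (A w \<inter> A w') \<le> (prob (A 0))\<^sup>2 + \<kappa>" if "(w, w') \<in> P" for w w'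
  proof -
    have w: "w \<in> integer_lattice" "w' - w \<in> integer_lattice" "3 * real (8 * N) \<le> infnorm (w' - w)"
      using that J grid_lattice[of "2 * N" "2 * C"] unfolding P_def by auto
    have "prob (A (w' - w)) = prob (A 0)"
      using prob_event_at_translate[of "fast_configs K a b" "8 * N", OF E w(2), of "w' - w"]
      by (simp add: A_def)
    then have "covariance M (indicator (A 0)) (indicator (A (w' - w))) =
        prob (A 0 \<inter> A (w' - w)) - (prob (A 0))\<^sup>2"
      by (simp add: covariance_indicator[OF A A] power2_eq_square)
    moreover have "covariance M (indicator (A 0)) (indicator (A (w' - w))) \<le> \<kappa>"
      unfolding A_def using w integer_lattice_subset by (intro mix) auto
    moreover have "prob (A w \<inter> A w') = prob (A 0 \<inter> A (w' - w))"
      unfolding A_def by (rule prob_event_at_translate[of "fast_configs K a b" "8 * N", OF E w(1)])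
    ultimately show ?thesis by linarith
  qed
  have finP: "finite P" and cardP: "card P \<le> (4 * C + 1) ^ (2 * CARD('d))"
  proof -
    have "P \<subseteq> ?J \<times> ?J" unfolding P_def by auto
    moreover have "finite (?J \<times> ?J)" using finite_grid by blast
    ultimately show "finite P" by (rule finite_subset)
    have "card P \<le> card (?J \<times> ?J)" by (rule card_mono) fact+
    also have "\<dots> = card ?J * card ?J" by (rule card_cartesian_product)
    also have "\<dots> \<le> (2 * (2 * C) + 1) ^ CARD('d) * (2 * (2 * C) + 1) ^ CARD('d)"
      by (intro mult_mono card_grid_le) auto
    finally show "card P \<le> (4 * C + 1) ^ (2 * CARD('d))"
      by (simp only: mult_2[of "CARD('d)"] power_add) (simp add: mult.assoc[symmetric])
  qed
  have "event_at M G (fast_configs K a' (4 * real (8 * N))) (8 * N * C) 0 \<subseteq>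
      long_edge_event M G (8 * N * C) N \<union> (\<Union>p\<in>P. A (fst p) \<inter> A (snd p))"
  proof
    fix \<omega> assume "\<omega> \<in> event_at M G (fast_configs K a' (4 * real (8 * N))) (8 * N * C) 0"
    then have \<omega>: "\<omega> \<in> space M"
      and fast: "fast_walk (G \<omega>) (cube (real (8 * N * C)) 0) a' (4 * real (8 * N))"
      unfolding event_at_fast_configs by auto
    have sym: "sym (edges (G \<omega>))" using G_configs[OF \<omega>] unfolding graph_configs_def by blast
    show "\<omega> \<in> long_edge_event M G (8 * N * C) N \<union> (\<Union>p\<in>P. A (fst p) \<inter> A (snd p))"
    proof (cases "\<omega> \<in> long_edge_event M G (8 * N * C) N")
      case False
      have short: "norm (loc u - loc v) \<le> real N"
        if "(u, v) \<in> edges (G \<omega>)" "loc u \<in> cube (real (8 * N * C)) 0"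
          "loc v \<in> cube (real (8 * N * C)) 0" for u v
        using \<omega> False that by (rule edge_length_le)
      obtain w w' where w: "w \<in> ?J" "w' \<in> ?J" "3 * real (8 * N) \<le> infnorm (w - w')"
        "fast_walk (G \<omega>) (cube (real (8 * N)) w) a b" "fast_walk (G \<omega>) (cube (real (8 * N)) w') a b"
        using fast_walk_imp_distant_fast_boxes[OF sym N fast short _ _ b a'] a by auto
      have "(w, w') \<in> P" using w(1-3) infnorm_sub[of w w'] unfolding P_def by auto
      moreover have "\<omega> \<in> A w \<inter> A w'" unfolding A_def event_at_fast_configs using \<omega> w by auto
      ultimately show ?thesis by force
    qed simp
  qed
  then have "prob (event_at M G (fast_configs K a' (4 * real (8 * N))) (8 * N * C) 0) \<le>
      prob (long_edge_event M G (8 * N * C) N \<union> (\<Union>p\<in>P. A (fst p) \<inter> A (snd p)))"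
    using A finP long_edge_event_in_events
    by (intro finite_measure_mono sets.Un sets.finite_UN sets.Int) auto
  also have "\<dots> \<le> prob (long_edge_event M G (8 * N * C) N) + prob (\<Union>p\<in>P. A (fst p) \<inter> A (snd p))"
    using A finP long_edge_event_in_events
    by (intro measure_Un_le sets.finite_UN sets.Int) auto
  also have "prob (\<Union>p\<in>P. A (fst p) \<inter> A (snd p)) \<le> (\<Sum>p\<in>P. prob (A (fst p) \<inter> A (snd p)))"
    using A finP by (intro finite_measure_subadditive_finite) auto
  also have "\<dots> \<le> (\<Sum>p\<in>P. (prob (A 0))\<^sup>2 + \<kappa>)"
    using far by (intro sum_mono) auto
  also have "\<dots> = real (card P) * ((prob (A 0))\<^sup>2 + \<kappa>)" by simp
  also have "\<dots> \<le> real ((4 * C + 1) ^ (2 * CARD('d))) * ((prob (A 0))\<^sup>2 + \<kappa>)"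
    using cardP \<kappa> by (intro mult_right_mono) (auto simp del: of_nat_power)
  finally show ?thesis by (simp add: A_def)
qed

end


section \<open>Boxes of growing size and the multiscale bound\<close>

text \<open>The ratios grow quadratically, so that their reciprocals are summable. The precise form makes the product
of the factors \<open>1 - slack N k / mesh N k = 1 - 1 / (k + 2)\<^sup>2\<close> for \<open>k \<ge> 1\<close>
telescope to the closed form of \<open>speed\<close>; for \<open>k = 0\<close> the slack is 0.\<close>

definition ratio :: "nat \<Rightarrow> nat" where
  "ratio k = 32 * (k + 3)\<^sup>2"

fun mesh :: "nat \<Rightarrow> nat \<Rightarrow> nat" where
  "mesh N 0 = N"
| "mesh N (Suc k) = mesh N k * ratio k"

text \<open>The rate at level 0 is the reciprocal of the side \<open>8 * N\<close>: within one box of that side a walk with at least one step satisfies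
the bound trivially.\<close>

definition speed :: "nat \<Rightarrow> nat \<Rightarrow> real" where
  "speed N k = 1 / (8 * real N) * ((real k + 2) / (2 * (real k + 1)))"

fun slack :: "nat \<Rightarrow> nat \<Rightarrow> real" where
  "slack N 0 = 0"
| "slack N (Suc k) = 4 * real (8 * mesh N k)"

lemma ratio_ge: "32 \<le> ratio k"
  unfolding ratio_def by (simp add: power2_eq_square)

lemma mesh_pos: "0 < N \<Longrightarrow> 0 < mesh N k"
  by (induction k) (auto simp: ratio_def)

lemma mesh_ge: "N * 32 ^ k \<le> mesh N k"
proof (induction k)
  case (Suc k)
  have "N * 32 ^ k * 32 \<le> mesh N k * ratio k"
    by (intro mult_le_mono Suc ratio_ge)
  then show ?case by (simp add: mult.assoc mult.commute)
qed simp

lemma mesh_add_ge: "mesh N k * 32 ^ i \<le> mesh N (k + i)"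
proof (induction i)
  case (Suc i)
  have "mesh N k * 32 ^ i * 32 \<le> mesh N (k + i) * ratio (k + i)"
    by (intro mult_le_mono Suc ratio_ge)
  then show ?case by (simp add: mult.assoc mult.commute)
qed simp

lemma mesh_mono: "j \<le> k \<Longrightarrow> mesh N j \<le> mesh N k"
  using mesh_add_ge[of N j "k - j"] by (metis le_add_diff_inverse le_trans mult_le_mono2 nat_mult_1_right one_le_numeral one_le_power)

lemma slack_nonneg: "0 \<le> slack N k"
  by (cases k) auto

lemma speed_pos: "0 < N \<Longrightarrow> 0 < speed N k"
  unfolding speed_def by simp

lemma speed_ge: "1 / (16 * real N) \<le> speed N k"
proof -
  have "1 / 2 \<le> (real k + 2) / (2 * (real k + 1))" by (simp add: field_simps)
  then have "1 / (8 * real N) * (1 / 2) \<le> speed N k"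
    unfolding speed_def by (intro mult_left_mono) auto
  then show ?thesis by simp
qed

lemma slack_Suc_div_mesh:
  assumes "0 < N"
  shows "slack N (Suc k) / real (mesh N (Suc k)) = 1 / (real k + 3)\<^sup>2"
  using mesh_pos[OF assms, of k] by (simp add: ratio_def field_simps)

lemma speed_step:
  assumes "0 < N"
  shows "speed N (Suc k) \<le> speed N k * (1 - slack N k / real (mesh N k))"
proof (cases k)
  case 0
  then show ?thesis using assms by (simp add: speed_def field_simps)
next
  case (Suc j)
  have *: "(x + 4) / (2 * (x + 3)) = (x + 3) / (2 * (x + 2)) * (1 - 1 / (x + 3)\<^sup>2)" if "0 \<le> x" for x :: real
  proof -
    have "x + 2 \<noteq> 0" "x + 3 \<noteq> 0" using that by auto
    then show ?thesis by (simp add: divide_simps) algebra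
  qed
  show ?thesis
    unfolding Suc slack_Suc_div_mesh[OF assms] speed_def
    using *[of "real j"] by (simp add: add.commute)
qed


context random_spatial_graph
begin

lemma no_fast_walk_mesh_0:
  assumes N: "0 < N"
  shows "event_at M G (fast_configs K (speed N 0) (slack N 0)) (8 * mesh N 0) 0 = {}"
proof -
  have "\<not> fast_walk g (cube (real (8 * N)) 0) (speed N 0) 0" for g :: "('d, 'k) graph"
  proof
    assume "fast_walk g (cube (real (8 * N)) 0) (speed N 0) 0"
    then obtain l u where w: "walk g (cube (real (8 * N)) 0) l u"
      and l: "real l < speed N 0 * infnorm (loc (u 0) - loc (u l))"
      unfolding fast_walk_def by auto
    then have "l \<noteq> 0" by (intro notI) (simp add: infnorm_0)
    have "loc (u 0) \<in> cube (real (8 * N)) 0" "loc (u l) \<in> cube (real (8 * N)) 0"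
      using w unfolding walk_def by auto
    then have "\<bar>(loc (u 0) - loc (u l)) $ i\<bar> \<le> real (8 * N)" for i
      unfolding cube_def by (simp add: abs_le_iff) (smt (verit))
    then have "infnorm (loc (u 0) - loc (u l)) \<le> real (8 * N)"
      unfolding infnorm_le_iff_cart by blast
    then have "speed N 0 * infnorm (loc (u 0) - loc (u l)) \<le> speed N 0 * real (8 * N)"
      using speed_pos[OF N, of 0] by (intro mult_left_mono) auto
    also have "\<dots> = 1" using N by (simp add: speed_def)
    finally show False using l \<open>l \<noteq> 0\<close> by simp
  qed
  then show ?thesis unfolding event_at_fast_configs by simp
qed

text \<open>With \<open>\<beta> = - \<alpha> / 2 > 0\<close> the induction carries \<open>p k \<le> mesh N k powr (- \<beta>)\<close>. One step then gives the bound
\<open>e k\<close>, which has the full exponent \<open>\<alpha>\<close> but a factor polynomial in \<open>k\<close>. It is again below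
\<open>mesh N (k + 1) powr (- \<beta>)\<close>, since half of the exponent is left to beat the polynomial: \<open>mesh N k \<ge> N * 32 ^ k\<close>,
and a large \<open>N\<close> takes care of small \<open>k\<close>. All constants are fixed before \<open>N\<close> is chosen.\<close>

lemma multiscale_bound:
  fixes \<xi> \<mu> :: real
  defines "\<alpha> \<equiv> max \<xi> (real CARD('d) + \<mu>)"
  assumes \<xi>: "\<xi> < 0" and mix: "polynomially_mixing M K T G \<xi>"
    and \<mu>: "\<mu> < - real CARD('d)" and edge: "no_long_edges M G \<mu>"
  shows "\<exists>N A. 0 < N \<and> (\<forall>k.
    prob (event_at M G (fast_configs K (speed N (Suc k)) (slack N (Suc k))) (8 * mesh N (Suc k)) 0) \<le>
      A * real (ratio k) ^ (2 * CARD('d)) * real (mesh N k) powr \<alpha> \<and>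
    prob (long_edge_event M G (8 * mesh N (Suc k)) (mesh N k)) \<le>
      A * real (ratio k) ^ (2 * CARD('d)) * real (mesh N k) powr \<alpha>)"
proof -
  let ?d = "CARD('d)"
  have \<alpha>: "\<alpha> < 0" "\<xi> \<le> \<alpha>" "real ?d + \<mu> \<le> \<alpha>" using \<xi> \<mu> unfolding \<alpha>_def by auto
  \<comment> \<open>The constants of mixing and of long edges do not involve the scales.\<close>
  obtain Cm m0 where Cm: "0 < Cm" and mix': "\<And>m E z. m0 \<le> m \<Longrightarrow> local_event M K G E \<Longrightarrow> z \<in> T \<Longrightarrow>
      3 * real m \<le> infnorm z \<Longrightarrow>
      covariance M (indicator (event_at M G E m 0)) (indicator (event_at M G E m z)) \<le> Cm * real m powr \<xi>"
    using uniform_mixing[OF mix] unfolding eventually_sequentially by blast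
  obtain Ce n0 where Ce: "0 < Ce" and edge': "\<And>m n. n0 \<le> n \<Longrightarrow> 1 \<le> m \<Longrightarrow>
      prob (long_edge_event M G m n) \<le> Ce * real m ^ ?d * real n powr \<mu>"
    using edge unfolding no_long_edges_def eventually_sequentially by blast
  define A where "A = Ce * 8 ^ ?d + 25 ^ ?d * (1 + Cm)"
  define \<beta> where "\<beta> = - \<alpha> / 2"
  have \<beta>: "0 < \<beta>" using \<alpha> unfolding \<beta>_def by simp
  have "(\<lambda>k. A * (32 * (real k + 3)\<^sup>2) powr (2 * real ?d + \<beta>) / 32 powr (\<beta> * real k)) \<longlonglongrightarrow> 0"
    using \<beta> by real_asymp
  then have "Bseq (\<lambda>k. A * (32 * (real k + 3)\<^sup>2) powr (2 * real ?d + \<beta>) / 32 powr (\<beta> * real k))"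
    by (intro convergent_imp_Bseq convergentI)
  then obtain B where B: "0 < B"
    "\<And>k. \<bar>A * (32 * (real k + 3)\<^sup>2) powr (2 * real ?d + \<beta>) / 32 powr (\<beta> * real k)\<bar> \<le> B"
    unfolding Bseq_def real_norm_def by blast
  have growth: "A * real (ratio k) powr (2 * real ?d + \<beta>) \<le> B * 32 powr (\<beta> * real k)" for k
    using abs_le_D1[OF B(2)[of k]] by (simp add: ratio_def divide_le_eq)
  have "\<forall>\<^sub>F n in sequentially. B \<le> real n powr \<beta>"
    using \<beta> by real_asymp
  then have "\<forall>\<^sub>F n in sequentially. B \<le> real n powr \<beta> \<and> m0 \<le> n \<and> n0 \<le> n \<and> 0 < n"
    by (intro eventually_conj eventually_ge_at_top eventually_gt_at_top)
  then obtain N where N: "B \<le> real N powr \<beta>" "m0 \<le> N" "n0 \<le> N" "0 < N"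
    using eventually_happens'[OF sequentially_bot] by blast
  define p where "p k = prob (event_at M G (fast_configs K (speed N k) (slack N k)) (8 * mesh N k) 0)" for k
  define e where "e k = A * real (ratio k) ^ (2 * ?d) * real (mesh N k) powr \<alpha>" for k
  have pos: "0 < mesh N k" for k by (rule mesh_pos[OF N(4)])
  have large: "m0 \<le> 8 * mesh N k" "n0 \<le> mesh N k" for k
    using mesh_mono[of 0 k N] N by auto
  have e: "e k \<le> real (mesh N (Suc k)) powr (\<alpha> / 2)" for k
  proof -
    let ?C = "real (ratio k)" and ?s = "real (mesh N k)"
    have C: "0 < ?C" using ratio_ge[of k] by simp
    have "A * ?C powr (2 * real ?d + \<beta>) \<le> real N powr \<beta> * 32 powr (\<beta> * real k)"
      by (rule order_trans[OF growth mult_right_mono[OF N(1)]]) simp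
    also have "\<dots> = real (N * 32 ^ k) powr \<beta>"
      by (simp add: powr_mult powr_powr mult.commute flip: powr_realpow)
    also have "\<dots> \<le> ?s powr \<beta>"
      using mesh_ge[of N k] \<beta> by (intro powr_mono2) (auto simp del: of_nat_mult of_nat_power)
    finally have "A * ?C powr (2 * real ?d + \<beta>) * (?C powr (- \<beta>) * ?s powr (- (2 * \<beta>)))
        \<le> ?s powr \<beta> * (?C powr (- \<beta>) * ?s powr (- (2 * \<beta>)))"
      by (rule mult_right_mono) simp
    moreover have eq1: "?C powr (2 * real ?d + \<beta>) * ?C powr (- \<beta>) = ?C ^ (2 * ?d)"
      using C by (simp flip: powr_add powr_realpow)
    moreover have eq2: "?s powr \<beta> * ?s powr (- (2 * \<beta>)) = ?s powr (- \<beta>)"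
      by (simp flip: powr_add)
    ultimately have "A * ?C ^ (2 * ?d) * ?s powr (- (2 * \<beta>)) \<le> ?s powr (- \<beta>) * ?C powr (- \<beta>)"
      unfolding eq1[symmetric] eq2[symmetric] by (simp only: mult_ac)
    then show ?thesis
      unfolding e_def \<beta>_def by (simp add: powr_mult)
  qed
  have edge_e: "prob (long_edge_event M G (8 * mesh N (Suc k)) (mesh N k)) \<le>
      Ce * 8 ^ ?d * (real (ratio k) ^ (2 * ?d) * real (mesh N k) powr \<alpha>)" for k
  proof -
    let ?C = "real (ratio k)" and ?s = "real (mesh N k)"
    have "prob (long_edge_event M G (8 * mesh N (Suc k)) (mesh N k)) \<le>
        Ce * real (8 * mesh N (Suc k)) ^ ?d * ?s powr \<mu>"
      using pos[of "Suc k"] by (intro edge' large) simp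
    also have "\<dots> = Ce * 8 ^ ?d * (?C ^ ?d * (?s ^ ?d * ?s powr \<mu>))"
      by (simp add: power_mult_distrib)
    also have "?s ^ ?d * ?s powr \<mu> = ?s powr (real ?d + \<mu>)"
      using pos[of k] by (simp add: powr_add powr_realpow)
    also have "?C ^ ?d * ?s powr (real ?d + \<mu>) \<le> ?C ^ (2 * ?d) * ?s powr \<alpha>"
      using pos[of k] ratio_ge[of k] \<alpha>(3) by (intro mult_mono power_increasing powr_mono) auto
    finally show ?thesis using Ce by simp
  qed
  have step: "p (Suc k) \<le> e k" if "p k \<le> real (mesh N k) powr (\<alpha> / 2)" for k
  proof -
    let ?C = "real (ratio k)" and ?s = "real (mesh N k)"
    let ?X = "?C ^ (2 * ?d) * ?s powr \<alpha>"
    let ?\<kappa> = "Cm * real (8 * mesh N k) powr \<xi>"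
    have loc: "local_event M K G (fast_configs K (speed N k) (slack N k))"
      using N(4) by (intro local_fast_configs speed_pos slack_nonneg)
    have "prob (event_at M G (fast_configs K (speed N (Suc k)) (4 * real (8 * mesh N k)))
          (8 * mesh N k * ratio k) 0) \<le>
        prob (long_edge_event M G (8 * mesh N k * ratio k) (mesh N k)) +
        real ((4 * ratio k + 1) ^ (2 * ?d)) * ((p k)\<^sup>2 + ?\<kappa>)"
      unfolding p_def using N(4) Cm
      by (intro prob_fast_walk_step speed_step pos speed_pos slack_nonneg mix'[OF large(1) loc]) auto
    moreover have "8 * mesh N k * ratio k = 8 * mesh N (Suc k)" by simp
    ultimately have "p (Suc k) \<le> prob (long_edge_event M G (8 * mesh N (Suc k)) (mesh N k)) +
        real ((4 * ratio k + 1) ^ (2 * ?d)) * ((p k)\<^sup>2 + ?\<kappa>)"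
      unfolding p_def slack.simps by metis
    moreover have "(p k)\<^sup>2 \<le> ?s powr \<alpha>"
    proof -
      have "(p k)\<^sup>2 \<le> (?s powr (\<alpha> / 2))\<^sup>2"
        using that by (intro power_mono) (auto simp: p_def)
      then show ?thesis by (simp add: power2_eq_square flip: powr_add)
    qed
    moreover have "?\<kappa> \<le> Cm * ?s powr \<alpha>"
    proof -
      have "real (8 * mesh N k) powr \<xi> \<le> ?s powr \<xi>"
        using pos[of k] \<xi> by (intro powr_mono2') auto
      also have "\<dots> \<le> ?s powr \<alpha>" using pos[of k] \<alpha>(2) by (intro powr_mono) auto
      finally show ?thesis using Cm by simp
    qed
    moreover have "real ((4 * ratio k + 1) ^ (2 * ?d)) \<le> 25 ^ ?d * ?C ^ (2 * ?d)"
    proof -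
      have "real ((4 * ratio k + 1) ^ (2 * ?d)) \<le> real ((5 * ratio k) ^ (2 * ?d))"
        using ratio_ge[of k] by (intro of_nat_mono power_mono) auto
      also have "\<dots> = 25 ^ ?d * ?C ^ (2 * ?d)"
        by (simp add: power_mult_distrib power_mult[of 5])
      finally show ?thesis .
    qed
    ultimately have "real ((4 * ratio k + 1) ^ (2 * ?d)) * ((p k)\<^sup>2 + ?\<kappa>) \<le>
        25 ^ ?d * ?C ^ (2 * ?d) * (?s powr \<alpha> + Cm * ?s powr \<alpha>)"
      and "p (Suc k) \<le> prob (long_edge_event M G (8 * mesh N (Suc k)) (mesh N k)) +
        real ((4 * ratio k + 1) ^ (2 * ?d)) * ((p k)\<^sup>2 + ?\<kappa>)"
      using Cm by (auto simp del: of_nat_power intro!: mult_mono add_mono add_nonneg_nonneg)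
    with edge_e[of k] have "p (Suc k) \<le> Ce * 8 ^ ?d * ?X +
        25 ^ ?d * ?C ^ (2 * ?d) * (?s powr \<alpha> + Cm * ?s powr \<alpha>)" by linarith
    also have "\<dots> = e k" unfolding e_def A_def by (simp add: algebra_simps)
    finally show ?thesis .
  qed
  have "p k \<le> real (mesh N k) powr (\<alpha> / 2)" for k
  proof (induction k)
    case 0
    show ?case unfolding p_def no_fast_walk_mesh_0[OF N(4)] by simp
  next
    case (Suc k)
    show ?case using step[OF Suc] e[of k] by (rule order_trans)
  qed
  then have "p (Suc k) \<le> e k" for k by (rule step)
  moreover have "prob (long_edge_event M G (8 * mesh N (Suc k)) (mesh N k)) \<le> e k" for k
  proof -
    have "Ce * 8 ^ ?d \<le> A" unfolding A_def using Cm by simp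
    then have "Ce * 8 ^ ?d * (real (ratio k) ^ (2 * ?d) * real (mesh N k) powr \<alpha>) \<le> e k"
      unfolding e_def mult.assoc[of A] by (rule mult_right_mono) simp
    with edge_e[of k] show ?thesis by (rule order_trans)
  qed
  ultimately show ?thesis
    using N(4) unfolding p_def e_def by (intro exI[of _ N] exI[of _ A]) blast
qed

end

section \<open>From all large boxes around the origin to a linear lower bound\<close>

lemma infnorm_ge_outside_cube: "y \<notin> cube r 0 \<Longrightarrow> r / 2 \<le> infnorm (y :: real^'d::finite)"
proof (rule ccontr)
  assume "y \<notin> cube r 0" "\<not> r / 2 \<le> infnorm y"
  then show False using in_cubeI[of 0 y r] by (simp add: infnorm_neg)
qed

lemma infnorm_in_cube_le:
  assumes "y \<in> cube r 0"
  shows "infnorm (y :: real^'d::finite) \<le> r / 2"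
  unfolding infnorm_le_iff_cart
proof
  fix i
  have "- (r / 2) \<le> y $ i" "y $ i < r / 2" using assms unfolding cube_def by auto
  then show "\<bar>y $ i\<bar> \<le> r / 2" by linarith
qed

lemma cube_mono:
  assumes "r \<le> r'"
  shows "cube r x \<subseteq> cube r' (x :: real^'d::finite)"
proof
  fix y assume "y \<in> cube r x"
  then have y: "x $ i - r / 2 \<le> y $ i" "y $ i < x $ i + r / 2" for i unfolding cube_def by auto
  have "x $ i - r' / 2 \<le> y $ i \<and> y $ i < x $ i + r' / 2" for i
    using y[of i] assms by linarith
  then show "y \<in> cube r' x" unfolding cube_def by simp
qed

lemma le_mesh:
  assumes "0 < N"
  shows "n \<le> mesh N n"
proof -
  have "n \<le> 32 ^ n" by (rule less_imp_le, rule power_gt_expt) simp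
  also have "1 * 32 ^ n \<le> N * 32 ^ n" using assms by (intro mult_le_mono1) simp
  also have "\<dots> \<le> mesh N n" by (rule mesh_ge)
  finally show ?thesis by simp
qed

text \<open>Let \<open>Suc j\<close> be the first level whose centred box contains the whole walk. If the end is at distance at least
\<open>64 * mesh N j\<close> from the start, the estimate in that box, with slack \<open>32 * mesh N j\<close>, loses at most half. Otherwise the
walk up to its first exit from the level \<open>j\<close> box suffices: edges inside the larger box are short, so the vertex before the exit
is at distance at least \<open>2 * mesh N j\<close> from the start, of which the slack takes at most one half. This costs
the factor \<open>64\<close>; the factor \<open>16 * N\<close> comes from the lower bound on the rates.\<close>

lemma walk_linear_lower_bound:
  fixes g :: "('d::finite, 'k) graph"
  assumes N: "0 < N" and sym: "sym (edges g)" and k: "1 \<le> k" and w: "walk g UNIV l u"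
    and u0: "loc (u 0) \<in> cube (real L) 0" and L: "L \<le> 2 * mesh N k"
    and ul: "loc (u l) \<notin> cube (real (8 * mesh N k)) 0"
    and slow: "\<And>j. k \<le> j \<Longrightarrow> \<not> fast_walk g (cube (real (8 * mesh N j)) 0) (speed N j) (slack N j)"
    and short: "\<And>j v v'. k \<le> j \<Longrightarrow> (v, v') \<in> edges g \<Longrightarrow>
      loc v \<in> cube (real (8 * mesh N (Suc j))) 0 \<Longrightarrow> loc v' \<in> cube (real (8 * mesh N (Suc j))) 0 \<Longrightarrow>
      norm (loc v - loc v') \<le> real (mesh N j)"
  shows "1 / (16 * real N) / 64 * infnorm (loc (u 0) - loc (u l)) \<le> real l"
proof -
  define inside where "inside j t \<longleftrightarrow> (\<forall>i\<le>t. loc (u i) \<in> cube (real (8 * mesh N j)) 0)" for j t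
  have wi: "walk g (cube (real (8 * mesh N j)) 0) t u" if "inside j t" "t \<le> l" for j t
    using that w unfolding inside_def walk_def by auto
  have "\<exists>j. inside j l"
  proof -
    define r where "r = Max ((\<lambda>i. infnorm (loc (u i))) ` {..l})"
    obtain j :: nat where j: "r < real j" using reals_Archimedean2 by blast
    have "j \<le> mesh N j" by (rule le_mesh[OF N])
    have "inside j l"
      unfolding inside_def
    proof (intro allI impI in_cubeI)
      fix i assume "i \<le> l"
      then have "infnorm (loc (u i)) \<le> r" unfolding r_def by (intro Max_ge) auto
      moreover have "real j \<le> real (8 * mesh N j) / 2" using \<open>j \<le> mesh N j\<close> by simp
      ultimately show "infnorm (0 - loc (u i)) < real (8 * mesh N j) / 2"
        using j by (simp add: infnorm_neg)
    qed
    then show ?thesis ..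
  qed
  define J where "J = (LEAST j. inside j l)"
  have J: "inside J l" unfolding J_def using \<open>\<exists>j. inside j l\<close> by (rule LeastI_ex)
  \<comment> \<open>The last vertex lies outside the level \<open>k\<close> box, so the level \<open>J\<close> is larger.\<close>
  have "k < J"
  proof (rule ccontr)
    assume "\<not> k < J"
    then have "real (8 * mesh N J) \<le> real (8 * mesh N k)"
      using mesh_mono[of J k N] by simp
    moreover have "loc (u l) \<in> cube (real (8 * mesh N J)) 0" using J unfolding inside_def by simp
    ultimately show False using ul cube_mono by blast
  qed
  then obtain j where j: "J = Suc j" "k \<le> j" by (cases J) auto
  have nj: "\<not> inside j l" using not_less_Least[of j "\<lambda>j. inside j l"] unfolding J_def[symmetric] j by auto
  define c where "c = 1 / (16 * real N)"
  have c: "0 < c" "\<And>i. c \<le> speed N i" using N speed_ge unfolding c_def by auto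
  let ?s = "real (mesh N j)" and ?r = "infnorm (loc (u 0) - loc (u l))"
  show ?thesis
  proof (cases "64 * ?s \<le> ?r")
    case True
    have "speed N (Suc j) * (?r - 32 * ?s) \<le> real l"
      using slow[of "Suc j"] j wi[OF J] unfolding fast_walk_def by (force simp: not_less)
    moreover have "c * (?r / 64) \<le> speed N (Suc j) * (?r - 32 * ?s)"
      using c True infnorm_pos_le[of "loc (u 0) - loc (u l)"]
      by (intro mult_mono) (auto intro: order_trans[OF less_imp_le])
    ultimately show ?thesis unfolding c_def by simp
  next
    case False
    define t where "t = (LEAST t. t \<le> l \<and> loc (u t) \<notin> cube (real (8 * mesh N j)) 0)"
    have ex: "\<exists>t. t \<le> l \<and> loc (u t) \<notin> cube (real (8 * mesh N j)) 0"
      using nj unfolding inside_def by blast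
    have t: "t \<le> l" "loc (u t) \<notin> cube (real (8 * mesh N j)) 0"
      using LeastI_ex[OF ex] unfolding t_def by auto
    have before: "loc (u i) \<in> cube (real (8 * mesh N j)) 0" if "i < t" for i
      using not_less_Least[of i "\<lambda>t. t \<le> l \<and> loc (u t) \<notin> cube (real (8 * mesh N j)) 0"] that t(1)
      unfolding t_def[symmetric] by auto
    have x: "infnorm (loc (u 0)) \<le> ?s"
      using infnorm_in_cube_le[OF u0] L mesh_mono[OF j(2), of N] by linarith
    have far: "4 * ?s \<le> infnorm (loc (u t))" using infnorm_ge_outside_cube[OF t(2)] by simp
    have "t \<noteq> 0"
    proof
      assume "t = 0"
      then show False using far x mesh_pos[OF N, of j] by auto
    qed
    then obtain q where q: "t = Suc q" by (cases t) auto
    have "norm (loc (u q) - loc (u t)) \<le> ?s"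
    proof (rule short[OF j(2)])
      show "(u q, u t) \<in> edges g" using w t q unfolding walk_def by auto
    qed (use J t q in \<open>auto simp: inside_def j\<close>)
    then have "infnorm (loc (u q) - loc (u t)) \<le> ?s"
      using infnorm_le_norm order_trans by blast
    then have "4 * ?s - ?s - ?s \<le> infnorm (loc (u 0) - loc (u q))"
      using far x infnorm_triangle[of "loc (u 0)" "loc (u q) - loc (u 0)"]
        infnorm_triangle[of "loc (u q)" "loc (u t) - loc (u q)"]
        infnorm_sub[of "loc (u q)" "loc (u t)"] infnorm_sub[of "loc (u q)" "loc (u 0)"] by simp
    moreover have "slack N j \<le> ?s"
    proof -
      obtain i where i: "j = Suc i" using j(2) k by (cases j) auto
      have "slack N j / ?s \<le> 1" unfolding i slack_Suc_div_mesh[OF N] by (simp add: field_simps)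
      then show ?thesis using mesh_pos[OF N, of j] by (simp add: divide_le_eq)
    qed
    ultimately have "?s \<le> infnorm (loc (u 0) - loc (u q)) - slack N j" by linarith
    moreover have "speed N j * (infnorm (loc (u 0) - loc (u q)) - slack N j) \<le> real q"
      using slow[OF j(2)] wi[of j q] before q t(1) unfolding fast_walk_def inside_def
      by (force simp: not_less)
    moreover have "c * (?r / 64) \<le> c * ?s" using False c by (intro mult_left_mono) auto
    moreover have "c * ?s \<le> speed N j * ?s" using c by (intro mult_right_mono) auto
    moreover have "speed N j * ?s \<le> speed N j * (infnorm (loc (u 0) - loc (u q)) - slack N j)"
      using calculation(1) speed_pos[OF N, of j] by (intro mult_left_mono) auto
    moreover have "real q \<le> real l" using q t(1) by simp
    ultimately show ?thesis unfolding c_def by linarith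
  qed
qed

lemma norm_le_CARD_infnorm: "norm (z :: real^'d::finite) \<le> real CARD('d) * infnorm z"
proof -
  have "norm z \<le> (\<Sum>i\<in>UNIV. \<bar>z $ i\<bar>)" by (rule norm_le_l1_cart)
  also have "\<dots> \<le> (\<Sum>i\<in>(UNIV :: 'd set). infnorm z)"
    by (intro sum_mono) (rule component_le_infnorm_cart)
  finally show ?thesis by simp
qed

lemma is_path_walk:
  assumes "is_path g x p y"
  shows "walk g UNIV (length p - 1) ((!) p)" "p ! 0 = x" "p ! (length p - 1) = y"
proof -
  have p: "p \<noteq> []" "set p \<subseteq> verts g" "successively (\<lambda>u v. (u, v) \<in> edges g) p" "hd p = x" "last p = y"
    using assms unfolding is_path_def by auto
  show "walk g UNIV (length p - 1) ((!) p)"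
    unfolding walk_def
  proof (intro conjI allI impI)
    fix i assume "i \<le> length p - 1"
    then have "i < length p" using p(1) by (cases p) auto
    then show "p ! i \<in> verts g" using p(2) nth_mem by blast
  next
    fix i assume "i < length p - 1"
    then show "(p ! i, p ! Suc i) \<in> edges g"
      using p(3) by (auto simp: successively_conv_nth)
  qed simp
  show "p ! 0 = x" "p ! (length p - 1) = y"
    using p by (auto simp: hd_conv_nth last_conv_nth)
qed

lemma graph_dist_ge:
  assumes "\<And>p. is_path g x p y \<Longrightarrow> r \<le> real (length p - 1)"
  shows "ereal r \<le> ereal_of_enat (graph_dist g x y)"
proof (cases "\<exists>p. is_path g x p y")
  case True
  then have "(\<lambda>p. enat (length p - 1)) ` {p. is_path g x p y} \<noteq> {}" by blast
  then have "graph_dist g x y \<in> (\<lambda>p. enat (length p - 1)) ` {p. is_path g x p y}"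
    unfolding graph_dist_def by (metis Inf_enat_def LeastI_ex ex_in_conv)
  then show ?thesis using assms by auto
next
  case False
  then show ?thesis by (simp add: graph_dist_def top_enat_def)
qed

context random_spatial_graph
begin

text \<open>The factor \<open>CARD('d)\<close> in the rate passes from the sup-norm to the Euclidean norm.\<close>

lemma not_linear_dist_subset:
  assumes N: "0 < N" and k: "1 \<le> k" and L: "L \<le> 2 * mesh N k" and m: "real (8 * mesh N k) \<le> m"
  shows "space M - linear_dist_event M G (1 / (16 * real N) / 64 / real CARD('d)) L m \<subseteq>
    (\<Union>j. event_at M G (fast_configs K (speed N (k + j)) (slack N (k + j))) (8 * mesh N (k + j)) 0 \<union>
      long_edge_event M G (8 * mesh N (Suc (k + j))) (mesh N (k + j)))" (is "?D \<subseteq> ?U")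
proof (rule subsetI, rule ccontr)
  let ?c = "1 / (16 * real N) / 64"
  fix \<omega> assume D: "\<omega> \<in> ?D" and U: "\<omega> \<notin> ?U"
  then have \<omega>: "\<omega> \<in> space M" by blast
  have sym: "sym (edges (G \<omega>))" using G_configs[OF \<omega>] unfolding graph_configs_def by blast
  have slow: "\<not> fast_walk (G \<omega>) (cube (real (8 * mesh N j)) 0) (speed N j) (slack N j)" if "k \<le> j" for j
  proof -
    have "\<omega> \<notin> event_at M G (fast_configs K (speed N (k + (j - k))) (slack N (k + (j - k))))
        (8 * mesh N (k + (j - k))) 0"
      using U by blast
    then show ?thesis unfolding event_at_fast_configs using \<omega> that by simp
  qed
  have short: "norm (loc v - loc v') \<le> real (mesh N j)"
    if "k \<le> j" "(v, v') \<in> edges (G \<omega>)" "loc v \<in> cube (real (8 * mesh N (Suc j))) 0"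
      "loc v' \<in> cube (real (8 * mesh N (Suc j))) 0" for j v v'
  proof -
    have "\<omega> \<notin> long_edge_event M G (8 * mesh N (Suc (k + (j - k)))) (mesh N (k + (j - k)))"
      using U by blast
    then have "\<omega> \<notin> long_edge_event M G (8 * mesh N (Suc j)) (mesh N j)" using that(1) by simp
    with \<omega> show ?thesis using that(2-) by (rule edge_length_le)
  qed
  have "\<omega> \<in> linear_dist_event M G (?c / real CARD('d)) L m"
    unfolding linear_dist_event_def
  proof (intro CollectI conjI ballI impI \<omega> graph_dist_ge)
    fix x y p assume x: "loc x \<in> cube (real L) 0" and y: "loc y \<notin> cube m 0" and p: "is_path (G \<omega>) x p y"
    have "loc y \<notin> cube (real (8 * mesh N k)) 0"
      using y cube_mono[OF m] by blast
    then have "?c * infnorm (loc (p ! 0) - loc (p ! (length p - 1))) \<le> real (length p - 1)"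
      using x is_path_walk[OF p]
      by (intro walk_linear_lower_bound[OF N sym k _ _ L _ slow short]) auto
    then have "?c * infnorm (loc x - loc y) \<le> real (length p - 1)"
      by (simp only: is_path_walk(2,3)[OF p])
    moreover have "?c / real CARD('d) * norm (loc x - loc y) \<le>
        ?c / real CARD('d) * (real CARD('d) * infnorm (loc x - loc y))"
      by (intro mult_left_mono norm_le_CARD_infnorm) simp
    ultimately show "?c / real CARD('d) * norm (loc x - loc y) \<le> real (length p - 1)" by simp
  qed
  then show False using D by blast
qed

text \<open>Summing the level probabilities from the largest level \<open>k\<close> with \<open>8 * mesh N k \<le> m\<close> on. The bound at
level \<open>k\<close> involves \<open>mesh N (k - 1)\<close>, whereas \<open>m\<close> may be nearly as large as \<open>8 * mesh N (k + 1)\<close>. The two are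
separated by two ratios, which are polynomial in \<open>k\<close>; giving up
\<open>\<gamma> - \<alpha>\<close> in the exponent pays for them and for the polynomial factor in the bound. The sum over the
levels is dominated by a geometric series with quotient \<open>32 powr \<gamma>\<close>.\<close>

lemma prob_not_linear_dist_le:
  fixes \<alpha> \<gamma> :: real
  assumes N: "0 < N"
    and fast: "\<And>k. prob (event_at M G (fast_configs K (speed N (Suc k)) (slack N (Suc k))) (8 * mesh N (Suc k)) 0)
      \<le> A * real (ratio k) ^ (2 * CARD('d)) * real (mesh N k) powr \<alpha>"
    and edge: "\<And>k. prob (long_edge_event M G (8 * mesh N (Suc k)) (mesh N k))
      \<le> A * real (ratio k) ^ (2 * CARD('d)) * real (mesh N k) powr \<alpha>"
    and \<gamma>: "\<alpha> < \<gamma>" "\<gamma> < 0"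
  shows "\<exists>B > 0. \<forall>\<^sub>F m in at_top.
    prob (space M - linear_dist_event M G (1 / (16 * real N) / 64 / real CARD('d)) L m) \<le> B * m powr \<gamma>"
proof -
  let ?d = "CARD('d)"
  define e where "e k = A * real (ratio k) ^ (2 * ?d) * real (mesh N k) powr \<alpha>" for k
  have pos: "0 < mesh N k" for k by (rule mesh_pos[OF N])
  have rpos: "0 < ratio k" for k using ratio_ge[of k] by simp
  have "(\<lambda>k. A * (32 * (real k + 3)\<^sup>2) ^ (2 * ?d) * (32 * (real k + 4)\<^sup>2) powr (- 2 * \<gamma>)
      / 32 powr ((\<gamma> - \<alpha>) * real k)) \<longlonglongrightarrow> 0"
    using \<gamma> by real_asymp
  then have "Bseq (\<lambda>k. A * (32 * (real k + 3)\<^sup>2) ^ (2 * ?d) * (32 * (real k + 4)\<^sup>2) powr (- 2 * \<gamma>)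
      / 32 powr ((\<gamma> - \<alpha>) * real k))"
    by (intro convergent_imp_Bseq convergentI)
  then obtain B where B: "0 < B"
    "\<And>k. \<bar>A * (32 * (real k + 3)\<^sup>2) ^ (2 * ?d) * (32 * (real k + 4)\<^sup>2) powr (- 2 * \<gamma>)
      / 32 powr ((\<gamma> - \<alpha>) * real k)\<bar> \<le> B"
    unfolding Bseq_def real_norm_def by blast
  have growth: "A * real (ratio k) ^ (2 * ?d) * real (ratio (Suc k)) powr (- 2 * \<gamma>)
      \<le> B * 32 powr ((\<gamma> - \<alpha>) * real k)" for k
    using abs_le_D1[OF B(2)[of k]] by (simp add: ratio_def divide_le_eq add.commute)
  \<comment> \<open>Two levels up, since \<open>m < 8 * mesh N (k + 1)\<close> and the bound for level \<open>k\<close> is \<open>e (k - 1)\<close>.\<close>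
  have e: "e k \<le> B * real (mesh N (k + 2)) powr \<gamma>" for k
  proof -
    let ?s = "real (mesh N k)" and ?C = "real (ratio (Suc k))"
    have "32 powr ((\<gamma> - \<alpha>) * real k) = real (32 ^ k) powr (\<gamma> - \<alpha>)"
      by (simp add: powr_powr mult.commute flip: powr_realpow)
    also have "\<dots> \<le> ?s powr (\<gamma> - \<alpha>)"
    proof (intro powr_mono2 of_nat_mono)
      have "1 * 32 ^ k \<le> N * 32 ^ k" using N by (intro mult_le_mono1) simp
      then show "32 ^ k \<le> mesh N k" using mesh_ge[of N k] by linarith
    qed (use \<gamma> in auto)
    finally have "B * 32 powr ((\<gamma> - \<alpha>) * real k) \<le> B * ?s powr (\<gamma> - \<alpha>)"
      using B(1) by simp
    with growth[of k] have "A * real (ratio k) ^ (2 * ?d) * ?C powr (- 2 * \<gamma>) \<le> B * ?s powr (\<gamma> - \<alpha>)"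
      by (rule order_trans)
    then have "A * real (ratio k) ^ (2 * ?d) * ?C powr (- 2 * \<gamma>) * (?C powr (2 * \<gamma>) * ?s powr \<alpha>)
        \<le> B * ?s powr (\<gamma> - \<alpha>) * (?C powr (2 * \<gamma>) * ?s powr \<alpha>)"
      by (rule mult_right_mono) simp
    moreover have "?C powr (- 2 * \<gamma>) * ?C powr (2 * \<gamma>) = 1"
      using rpos[of "Suc k"] by (simp flip: powr_add)
    moreover have "A * real (ratio k) ^ (2 * ?d) * ?C powr (- 2 * \<gamma>) * (?C powr (2 * \<gamma>) * ?s powr \<alpha>)
        = ?C powr (- 2 * \<gamma>) * ?C powr (2 * \<gamma>) * e k"
      unfolding e_def by (simp only: mult_ac)
    moreover have "?s powr (\<gamma> - \<alpha>) * ?s powr \<alpha> = ?s powr \<gamma>"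
      by (simp flip: powr_add)
    moreover have "B * ?s powr (\<gamma> - \<alpha>) * (?C powr (2 * \<gamma>) * ?s powr \<alpha>)
        = B * (?C powr (2 * \<gamma>) * (?s powr (\<gamma> - \<alpha>) * ?s powr \<alpha>))"
      by (simp only: mult_ac)
    ultimately have "e k \<le> B * (?C powr (2 * \<gamma>) * ?s powr \<gamma>)"
      by (simp only: mult_1)
    also have "?C powr (2 * \<gamma>) * ?s powr \<gamma> = (?C\<^sup>2 * ?s) powr \<gamma>"
    proof -
      have "?C powr (2 * \<gamma>) = (?C powr 2) powr \<gamma>" by (simp only: powr_powr)
      then show ?thesis using rpos[of "Suc k"] by (simp add: powr_mult powr_numeral)
    qed
    also have "\<dots> \<le> real (mesh N (k + 2)) powr \<gamma>"
    proof (rule powr_mono2')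
      have "ratio k \<le> ratio (Suc k)" unfolding ratio_def by simp
      then have "mesh N k * ratio k * ratio (Suc k) \<le> mesh N k * ratio (Suc k) * ratio (Suc k)"
        by simp
      then have "mesh N (k + 2) \<le> (ratio (Suc k))\<^sup>2 * mesh N k"
        by (simp add: power2_eq_square mult_ac)
      then have "real (mesh N (k + 2)) \<le> real ((ratio (Suc k))\<^sup>2 * mesh N k)"
        by (rule of_nat_mono)
      then show "real (mesh N (k + 2)) \<le> ?C\<^sup>2 * ?s" by simp
    qed (use \<gamma> pos[of "k + 2"] in auto)
    finally show ?thesis using B(1) by simp
  qed
  define q where "q = 32 powr \<gamma>"
  have q: "0 < q" "q < 1" using \<gamma> unfolding q_def by (auto simp: powr_less_one)
  have geo: "real (mesh N (k + i)) powr \<gamma> \<le> real (mesh N k) powr \<gamma> * q ^ i" for k i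
  proof -
    have "real (mesh N (k + i)) powr \<gamma> \<le> real (mesh N k * 32 ^ i) powr \<gamma>"
      using mesh_add_ge[of N k i] pos[of k] \<gamma> by (intro powr_mono2' of_nat_mono) auto
    also have "\<dots> = real (mesh N k) powr \<gamma> * q ^ i"
      unfolding q_def by (simp add: powr_mult powr_powr mult.commute flip: powr_realpow)
    finally show ?thesis .
  qed
  have main: "prob (space M - linear_dist_event M G (1 / (16 * real N) / 64 / real ?d) L m)
      \<le> 2 * B * real (mesh N (Suc k)) powr \<gamma> * (1 / (1 - q))"
    if k: "1 \<le> k" and L: "L \<le> 2 * mesh N k" and m: "real (8 * mesh N k) \<le> m" for k m
  proof -
    let ?F = "\<lambda>j. event_at M G (fast_configs K (speed N (k + j)) (slack N (k + j))) (8 * mesh N (k + j)) 0"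
    let ?E = "\<lambda>j. long_edge_event M G (8 * mesh N (Suc (k + j))) (mesh N (k + j))"
    let ?S = "real (mesh N (Suc k)) powr \<gamma>"
    have FE: "?F j \<in> events" "?E j \<in> events" for j
      using N by (auto intro!: long_edge_event_in_events event_at_in_events fast_configs_in_sets speed_pos slack_nonneg)
    have "prob (?F j \<union> ?E j) \<le> 2 * B * ?S * q ^ j" for j
    proof -
      obtain i where i: "k + j = Suc i" using k by (cases "k + j") auto
      have "prob (?F j) \<le> e i" using fast[of i] unfolding i e_def .
      also have "\<dots> \<le> B * real (mesh N (Suc k + j)) powr \<gamma>" using e[of i] i by simp
      also have "\<dots> \<le> B * (?S * q ^ j)" using B(1) geo[of "Suc k" j] by (intro mult_left_mono) auto
      finally have 1: "prob (?F j) \<le> B * (?S * q ^ j)" .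
      have "prob (?E j) \<le> e (k + j)" using edge[of "k + j"] unfolding e_def .
      also have "\<dots> \<le> B * real (mesh N (Suc k + Suc j)) powr \<gamma>" using e[of "k + j"] by simp
      also have "\<dots> \<le> B * (?S * q ^ Suc j)" using B(1) geo[of "Suc k" "Suc j"] by (intro mult_left_mono) auto
      also have "\<dots> \<le> B * (?S * q ^ j)"
        using B(1) q by (intro mult_left_mono power_decreasing) auto
      finally have "prob (?E j) \<le> B * (?S * q ^ j)" .
      with 1 show ?thesis using measure_Un_le[OF FE, of j j] by simp
    qed note bound = this
    have geo_sum: "(\<lambda>j. 2 * B * ?S * q ^ j) sums (2 * B * ?S * (1 / (1 - q)))"
      using q by (intro sums_mult geometric_sums) auto
    have summable: "summable (\<lambda>j. prob (?F j \<union> ?E j))"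
      by (rule summable_comparison_test'[OF sums_summable[OF geo_sum]]) (use bound in auto)
    have "prob (space M - linear_dist_event M G (1 / (16 * real N) / 64 / real ?d) L m)
        \<le> prob (\<Union>j. ?F j \<union> ?E j)"
      using FE by (intro finite_measure_mono[OF not_linear_dist_subset[OF N k L m]]) auto
    also have "\<dots> \<le> (\<Sum>j. prob (?F j \<union> ?E j))"
      using FE summable by (intro finite_measure_subadditive_countably) auto
    also have "\<dots> \<le> (\<Sum>j. 2 * B * ?S * q ^ j)"
      by (rule suminf_le[OF bound summable sums_summable[OF geo_sum]])
    also have "\<dots> = 2 * B * ?S * (1 / (1 - q))" by (rule sums_unique[OF geo_sum, symmetric])
    finally show ?thesis .
  qed
  define B' where "B' = 2 * B * (1 / 8) powr \<gamma> * (1 / (1 - q))"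
  show ?thesis
  proof (intro exI[of _ B'] conjI)
    show "0 < B'" unfolding B'_def using B q by simp
    show "\<forall>\<^sub>F m in at_top.
      prob (space M - linear_dist_event M G (1 / (16 * real N) / 64 / real ?d) L m) \<le> B' * m powr \<gamma>"
      using eventually_ge_at_top[of "real (8 * mesh N (Suc L))"]
    proof eventually_elim
      case (elim m)
      have ex: "\<exists>j. m < real (8 * mesh N j)"
      proof -
        obtain n where "m < real n" using reals_Archimedean2 by blast
        also have "real n \<le> real (8 * mesh N n)"
          using le_mesh[OF N, of n] by (intro of_nat_mono) simp
        finally show ?thesis by blast
      qed
      define j where "j = (LEAST j. m < real (8 * mesh N j))"
      have j: "m < real (8 * mesh N j)" unfolding j_def by (rule LeastI_ex[OF ex])
      have "Suc L < j"
      proof (rule ccontr)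
        assume "\<not> Suc L < j"
        then have "real (8 * mesh N j) \<le> real (8 * mesh N (Suc L))"
          by (intro of_nat_mono mult_le_mono2 mesh_mono) simp
        then show False using elim j by linarith
      qed
      then obtain k where k: "j = Suc k" "Suc L \<le> k" by (cases j) auto
      have "real (8 * mesh N k) \<le> m"
        using not_less_Least[of k "\<lambda>j. m < real (8 * mesh N j)"] k(1) unfolding j_def[symmetric] by simp
      moreover have "L \<le> 2 * mesh N k" using le_mesh[OF N, of k] k(2) by linarith
      ultimately have "prob (space M - linear_dist_event M G (1 / (16 * real N) / 64 / real ?d) L m)
          \<le> 2 * B * real (mesh N (Suc k)) powr \<gamma> * (1 / (1 - q))"
        using k(2) by (intro main) auto
      also have "real (mesh N (Suc k)) powr \<gamma> \<le> (1 / 8 * m) powr \<gamma>"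
      proof (rule powr_mono2')
        show "0 < 1 / 8 * m" using elim pos[of "Suc L"] by linarith
        show "1 / 8 * m \<le> real (mesh N (Suc k))" using j unfolding k(1) by linarith
      qed (use \<gamma> in simp)
      also have "\<dots> = (1 / 8) powr \<gamma> * m powr \<gamma>" by (rule powr_mult)
      finally show ?case using B(1) q by (simp add: B'_def mult_ac mult_left_mono divide_right_mono)
    qed
  qed
qed

end


section \<open>The decay exponent\<close>

lemma Limsup_log_ereal_le:
  fixes P :: "real \<Rightarrow> real"
  assumes B: "0 < B" and P: "\<And>m. 0 \<le> P m" and le: "\<forall>\<^sub>F m in at_top. P m \<le> B * m powr \<gamma>"
  shows "Limsup at_top (\<lambda>m. log_ereal (P m) / ereal (ln m)) \<le> ereal \<gamma>"
proof -
  have "\<forall>\<^sub>F m in at_top. log_ereal (P m) / ereal (ln m) \<le> ereal (ln B / ln m + \<gamma>)"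
    using le eventually_gt_at_top[of 1]
  proof eventually_elim
    case (elim m)
    then have ln: "0 < ln m" by simp
    show ?case
    proof (cases "P m = 0")
      case True
      then show ?thesis using ln by (simp add: log_ereal_def)
    next
      case False
      then have "0 < P m" using P[of m] by simp
      then have "ln (P m) \<le> ln (B * m powr \<gamma>)" using elim by (intro ln_mono) auto
      also have "\<dots> = ln B + \<gamma> * ln m" using B elim by (simp add: ln_mult ln_powr)
      finally show ?thesis using False ln by (simp add: log_ereal_def field_simps)
    qed
  qed
  then have "Limsup at_top (\<lambda>m. log_ereal (P m) / ereal (ln m)) \<le>
      Limsup at_top (\<lambda>m. ereal (ln B / ln m + \<gamma>))" by (rule Limsup_mono)
  also have "((\<lambda>m. ln B / ln m + \<gamma>) \<longlongrightarrow> \<gamma>) at_top" by real_asymp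
  then have "Limsup at_top (\<lambda>m. ereal (ln B / ln m + \<gamma>)) = ereal \<gamma>"
    by (intro lim_imp_Limsup) auto
  finally show ?thesis .
qed

theorem theorem1:
  fixes M :: "'w measure" and K :: "'k measure"
    and T :: "(real^'d) set" and G :: "'w \<Rightarrow> ('d::finite, 'k) graph"
    and \<xi> \<mu> :: real
  assumes "random_spatial_graph M K T G"
    and "\<xi> < 0" and "polynomially_mixing M K T G \<xi>"
    and "\<mu> < - real CARD('d)" and "no_long_edges M G \<mu>"
  shows "\<exists>\<eta> > 0. \<forall>L :: nat.
    Limsup at_top (\<lambda>m :: real.
      log_ereal (measure M (space M - linear_dist_event M G \<eta> L m)) / ereal (ln m))
    \<le> ereal (max \<xi> (real CARD('d) + \<mu>))"
proof -
  interpret random_spatial_graph M K T G by fact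
  define \<alpha> where "\<alpha> = max \<xi> (real CARD('d) + \<mu>)"
  have "\<alpha> < 0" using assms unfolding \<alpha>_def by auto
  obtain N A where N: "0 < N" and bound: "\<And>k.
    prob (event_at M G (fast_configs K (speed N (Suc k)) (slack N (Suc k))) (8 * mesh N (Suc k)) 0) \<le>
      A * real (ratio k) ^ (2 * CARD('d)) * real (mesh N k) powr \<alpha>"
    "\<And>k. prob (long_edge_event M G (8 * mesh N (Suc k)) (mesh N k)) \<le>
      A * real (ratio k) ^ (2 * CARD('d)) * real (mesh N k) powr \<alpha>"
    using multiscale_bound[OF assms(2-5)] unfolding \<alpha>_def by blast
  define \<eta> where "\<eta> = 1 / (16 * real N) / 64 / real CARD('d)"
  have "Limsup at_top (\<lambda>m. log_ereal (prob (space M - linear_dist_event M G \<eta> L m)) / ereal (ln m))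
      \<le> ereal \<alpha>" for L
  proof (rule ereal_le_epsilon2)
    fix \<epsilon> :: real assume "0 < \<epsilon>"
    define \<gamma> where "\<gamma> = min (\<alpha> + \<epsilon>) (\<alpha> / 2)"
    have \<gamma>: "\<alpha> < \<gamma>" "\<gamma> < 0" using \<open>0 < \<epsilon>\<close> \<open>\<alpha> < 0\<close> unfolding \<gamma>_def by auto
    obtain B where "0 < B"
      "\<forall>\<^sub>F m in at_top. prob (space M - linear_dist_event M G \<eta> L m) \<le> B * m powr \<gamma>"
      using prob_not_linear_dist_le[OF N bound \<gamma>] unfolding \<eta>_def by blast
    then have "Limsup at_top (\<lambda>m. log_ereal (prob (space M - linear_dist_event M G \<eta> L m)) / ereal (ln m))
        \<le> ereal \<gamma>" by (intro Limsup_log_ereal_le) auto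
    also have "\<dots> \<le> ereal \<alpha> + ereal \<epsilon>" unfolding \<gamma>_def by simp
    finally show "Limsup at_top (\<lambda>m. log_ereal (prob (space M - linear_dist_event M G \<eta> L m)) / ereal (ln m))
        \<le> ereal \<alpha> + ereal \<epsilon>" .
  qed
  moreover have "0 < \<eta>" unfolding \<eta>_def using N by simp
  ultimately show ?thesis unfolding \<alpha>_def by blast
qed

end
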